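(* Let $\lambda>0$, $0<\alpha\le1$, and let $\{D_f(t)\}_{t\ge0}$ be a Lévy subordinator, independent of $\{\hat N_\alpha(t)\}_{t\ge0}$, with $\mathbb E(D_f^r(t))<\infty$ for all $r>0$. Let $\hat N_\alpha^f(t)=\hat N_\alpha(D_f(t))$, $t\ge0$. Then the probability mass function $\hat p_\alpha^f(n,t)=\Pr\{\hat N_\alpha^f(t)=n\}$, $n\ge0$, is given by $$\begin{aligned}\hat p_\alpha^f(n,t)={}&\frac{\lambda^{2n}}{(2n)!}\sum_{k=0}^\infty\frac{(2n+k)!}{k!}\frac{(-\lambda)^k}{\Gamma(\alpha(2n+k)+1)}\mathbb E\big(D_f^{\alpha(2n+k)}(t)\big)\\&+\frac{\lambda^{2n+1}}{(2n+1)!}\sum_{k=0}^\infty\frac{(2n+k+1)!}{k!}\frac{(-\lambda)^k}{\Gamma(\alpha(2n+k+1)+1)}\mathbb E\big(D_f^{\alpha(2n+k+1)}(t)\big).\end{aligned}$$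
   Context: Three-parameter Mittag-Leffler function: $E_{\alpha,\beta}^{\gamma}(x)=\frac{1}{\Gamma(\gamma)}\sum_{j=0}^\infty\frac{\Gamma(j+\gamma)x^j}{j!\,\Gamma(j\alpha+\beta)}$ for $\alpha,\beta,\gamma>0$, $x\in\mathbb R$. For $\lambda>0$ and $0<\alpha\le1$, $\{\hat N_\alpha(t)\}_{t\ge0}$ is the renewal counting process with $\hat N_\alpha(0)=0$ whose i.i.d. interarrival times have density $\lambda^2t^{2\alpha-1}E^2_{\alpha,2\alpha}(-\lambda t^\alpha)$, $t>0$. Its probability mass function is, for $n\ge0$, $$\Pr\{\hat N_\alpha(t)=n\}=\lambda^{2n}t^{2n\alpha}E_{\alpha,2n\alpha+1}^{2n+1}(-\lambda t^\alpha)+\lambda^{2n+1}t^{(2n+1)\alpha}E_{\alpha,(2n+1)\alpha+1}^{2n+2}(-\lambda t^\alpha).$$ A Lévy subordinator $\{D_f(t)\}_{t\ge0}$ is a one-dimensional Lévy process with non-decreasing paths, $D_f(0)=0$ a.s., and $\mathbb E(e^{-sD_f(t)})=e^{-tf(s)}$, $s>0$, where $f(s)=cs+\int_0^\infty(1-e^{-sx})\bar\nu(\mathrm dx)$ is its Bernstein function ($c\ge0$, $\int_0^\infty(x\wedge1)\bar\nu(\mathrm dx)<\infty$). $D_f^{a}(t)$ denotes $(D_f(t))^a$.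
   Formalization: Convergence of the two series on the right-hand side (for the given n and t) is assumed; finite moments do not imply it: for α=1, λ=2, n=0, t=1 and the gamma subordinator f(s)=log(1+s), the first series is Σ(−2)^k. *)

theory Defs
  imports "HOL-Probability.Probability"
begin

definition mittag_leffler3 :: "real \<Rightarrow> real \<Rightarrow> real \<Rightarrow> real \<Rightarrow> real" where
  "mittag_leffler3 \<alpha> \<beta> \<gamma> x =
     1 / Gamma \<gamma> * (\<Sum>j. Gamma (real j + \<gamma>) * x ^ j / (fact j * Gamma (real j * \<alpha> + \<beta>)))"

definition interarrival_density :: "real \<Rightarrow> real \<Rightarrow> real \<Rightarrow> real" where
  "interarrival_density lam \<alpha> t =
     (if 0 < t then lam\<^sup>2 * t powr (2 * \<alpha> - 1) * mittag_leffler3 \<alpha> (2 * \<alpha>) 2 (- lam * t powr \<alpha>) else 0)"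

text \<open>
  The coercion \<^term>\<open>ennreal\<close> maps negative numbers to 0, so \<^const>\<open>distributed\<close> alone
  would only say that the positive part of \<open>f\<close> is a density of \<open>X\<close>.
\<close>

definition has_density :: "'a measure \<Rightarrow> ('a \<Rightarrow> real) \<Rightarrow> (real \<Rightarrow> real) \<Rightarrow> bool" where
  "has_density M X f \<longleftrightarrow>
     (AE x in lborel. 0 \<le> f x) \<and> distributed M lborel X (\<lambda>x. ennreal (f x))"

text \<open>
  The renewal counting process with interarrival times \<open>T 0, T 1, \<dots>\<close>: the number of
  renewal epochs in \<open>[0, t]\<close>. For i.i.d. positive interarrival times the
  counted set is almost surely finite; where it is infinite, \<^const>\<open>card\<close> returns 0.
\<close>

definition renewal_count :: "(nat \<Rightarrow> 'a \<Rightarrow> real) \<Rightarrow> real \<Rightarrow> 'a \<Rightarrow> nat" where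
  "renewal_count T t \<omega> = card {m. 1 \<le> m \<and> (\<Sum>i<m. T i \<omega>) \<le> t}"

definition levy_process :: "'a measure \<Rightarrow> (real \<Rightarrow> 'a \<Rightarrow> real) \<Rightarrow> bool" where
  "levy_process M D \<longleftrightarrow>
     (\<forall>t\<ge>0. D t \<in> borel_measurable M) \<and>
     (AE \<omega> in M. D 0 \<omega> = 0) \<and>
     (\<forall>(s :: nat \<Rightarrow> real) m. 0 \<le> s 0 \<longrightarrow> mono s \<longrightarrow>
        prob_space.indep_vars M (\<lambda>_. borel) (\<lambda>i \<omega>. D (s (Suc i)) \<omega> - D (s i) \<omega>) {..<m}) \<and>
     (\<forall>s t. 0 \<le> s \<longrightarrow> s \<le> t \<longrightarrow>
        distr M borel (\<lambda>\<omega>. D t \<omega> - D s \<omega>) = distr M borel (D (t - s))) \<and>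
     (\<forall>s\<ge>0. \<forall>\<epsilon>>0.
        ((\<lambda>t. measure M {\<omega> \<in> space M. \<bar>D t \<omega> - D s \<omega>\<bar> > \<epsilon>}) \<longlongrightarrow> 0) (at s within {0..}))"

definition bernstein_representation ::
    "real \<Rightarrow> real measure \<Rightarrow> (real \<Rightarrow> real) \<Rightarrow> bool" where
  "bernstein_representation c \<nu> f \<longleftrightarrow>
     0 \<le> c \<and> sets \<nu> = sets borel \<and>
     (\<integral>\<^sup>+x\<in>{0<..}. ennreal (min x 1) \<partial>\<nu>) < \<infinity> \<and>
     (\<forall>s>0. f s = c * s + (LINT x:{0<..}|\<nu>. 1 - exp (- s * x)))"

definition levy_subordinator ::
    "'a measure \<Rightarrow> (real \<Rightarrow> 'a \<Rightarrow> real) \<Rightarrow> (real \<Rightarrow> real) \<Rightarrow> bool" where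
  "levy_subordinator M D f \<longleftrightarrow>
     levy_process M D \<and>
     (AE \<omega> in M. mono_on {0..} (\<lambda>t. D t \<omega>)) \<and>
     (\<exists>c \<nu>. bernstein_representation c \<nu> f) \<and>
     (\<forall>t\<ge>0. \<forall>s>0. (LINT \<omega>|M. exp (- s * D t \<omega>)) = exp (- t * f s))"

text \<open>Independence of two processes as random elements of the path space \<open>\<real>\<^bsup>[0, \<infinity>)\<^esup>\<close>.\<close>

definition indep_processes ::
    "'a measure \<Rightarrow> (real \<Rightarrow> 'a \<Rightarrow> real) \<Rightarrow> (real \<Rightarrow> 'a \<Rightarrow> real) \<Rightarrow> bool" where
  "indep_processes M X Y \<longleftrightarrow>
     prob_space.indep_var M
       (Pi\<^sub>M {0..} (\<lambda>_. borel)) (\<lambda>\<omega>. \<lambda>t\<in>{0..}. X t \<omega>)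
       (Pi\<^sub>M {0..} (\<lambda>_. borel)) (\<lambda>\<omega>. \<lambda>t\<in>{0..}. Y t \<omega>)"

text \<open>
  Real power with the convention \<open>x\<^sup>0 = 1\<close> also at \<open>x = 0\<close>, whereas \<open>0 powr 0 = 0\<close>. The zeroth
  moment has to be 1 also when the subordinator vanishes with positive probability
  (at time 0, or in the compound Poisson case).
\<close>

definition rpow :: "real \<Rightarrow> real \<Rightarrow> real" where
  "rpow x r = (if r = 0 then 1 else x powr r)"

end

theory Submission
  imports Defs
begin

text \<open>
  Let \<open>S n\<close> be the time of the \<open>n\<close>-th renewal. The event \<open>n \<le> N(D t)\<close> is, up to a null set, the event
  \<open>S n \<le> D t\<close>, so the probability mass function is
  \<open>P(S n \<le> D t) - P(S (n + 1) \<le> D t)\<close>. An interarrival time has the law of a sum of two independent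
  Mittag-Leffler waiting times, hence \<open>S n\<close> has the law of a sum of \<open>2 * n\<close> of them, with distribution
  function \<open>F (2 * n)\<close>, where
  \<open>F r t = (\<Sum>j. (- r gchoose j) * x ^ (r + j) / \<Gamma>(\<alpha> * (r + j) + 1))\<close> at \<open>x = lam * t\<^sup>\<alpha>\<close>.
  These functions satisfy the convolution law \<open>ml_erlang_convolution\<close>, which is Euler's Beta integral for
  the individual terms and Vandermonde's identity for the coefficients. By Pascal's rule
  \<open>F r - F (r + 1)\<close> is \<open>x ^ r / r!\<close> times the \<open>r\<close>-th derivative of the Mittag-Leffler function at
  \<open>- x\<close> (\<open>ml_erlang_diff\<close>). The two series of the theorem are the expectations of
  \<open>F (2 * n) - F (2 * n + 1)\<close> and \<open>F (2 * n + 1) - F (2 * n + 2)\<close> at \<open>t = D t\<close>, expanded in powers.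

  The delicate point is the interchange of expectation and summation: the two series are only assumed to
  converge, not to converge absolutely, so dominated convergence is not available. The way out is that
  \<open>x \<mapsto> E\<^sub>\<alpha>(- x)\<close> is completely monotone for \<open>0 < \<alpha> \<le> 1\<close> (Pollard's theorem, here \<open>cm_seq_ml_coeff\<close>).
  The Taylor polynomials of a completely monotone function at 0 envelop it: the error is at most the first
  omitted term (\<open>cm_seq_enveloping\<close>). The inequality survives taking expectations,
  and the expectation of the first omitted term tends to 0 because it is a term of a convergent series
  (\<open>expectation_altexp_sums\<close>).

  Complete monotonicity is proved by elementary means. Euler's product for the Gamma function
  exhibits the values \<open>k! / \<Gamma>(\<alpha> * k + 1)\<close> of the derivatives at 0, up to sign, as increasing limits of
  \<open>(n + 1) powr ((1 - \<alpha>) * k) * (\<Prod>j\<le>n+2. (\<alpha> * k + j) / (k + j))\<close>, \<open>j\<close> starting at 1. Each factor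
  \<open>\<alpha> + (1 - \<alpha>) * j / (k + j)\<close> is the \<open>k\<close>-th moment of a mixture of a point mass at 1 and a Beta law,
  so the approximants are moment sequences of positive measures.
\<close>

section \<open>Completely monotone exponential generating functions\<close>

text \<open>
  The sequence \<open>c\<close> lists the derivatives at 0 of \<open>y \<mapsto> (\<Sum>k. c k * y ^ k / k!)\<close>, so that
  differentiation becomes a shift of \<open>c\<close>. The function is evaluated at \<open>- x\<close>, because the interest is in
  complete monotonicity on the positive half-line.
\<close>

definition altexp :: "(nat \<Rightarrow> real) \<Rightarrow> real \<Rightarrow> real" where
  "altexp c x = (\<Sum>k. c k * (-x) ^ k / fact k)"

definition entire_egf :: "(nat \<Rightarrow> real) \<Rightarrow> bool" where
  "entire_egf c \<longleftrightarrow> (\<forall>x. summable (\<lambda>k. c k * x ^ k / fact k))"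

lemma entire_egfD: "entire_egf c \<Longrightarrow> summable (\<lambda>k. c k * x ^ k / fact k)"
  by (simp add: entire_egf_def)

lemma entire_egf_Suc:
  assumes "entire_egf c"
  shows "entire_egf (\<lambda>k. c (Suc k))"
proof -
  have "summable (\<lambda>k. (c k / fact k) * y ^ k)" for y
    using entire_egfD[OF assms, of y] by (simp add: field_simps)
  then have "summable (\<lambda>k. diffs (\<lambda>k. c k / fact k) k * y ^ k)" for y
    by (intro termdiff_converges_all)
  moreover have "diffs (\<lambda>k. c k / fact k) k * y ^ k = c (Suc k) * y ^ k / fact k" for k y
    by (simp add: diffs_def del: of_nat_Suc)
  ultimately show ?thesis
    by (simp add: entire_egf_def)
qed

lemma entire_egf_shift: "entire_egf c \<Longrightarrow> entire_egf (\<lambda>k. c (k + m))"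
proof (induction m arbitrary: c)
  case (Suc m)
  from Suc.IH[OF entire_egf_Suc[OF Suc.prems]] show ?case by simp
qed simp

lemma altexp_deriv:
  assumes "entire_egf c"
  shows "(altexp c has_field_derivative - altexp (\<lambda>k. c (Suc k)) x) (at x)"
proof -
  let ?e = "\<lambda>k. c k * (-1) ^ k / fact k"
  have e: "?e k * y ^ k = c k * (-y) ^ k / fact k" for k y
    by (simp add: power_minus[of y])
  have s: "summable (\<lambda>k. ?e k * y ^ k)" for y
    unfolding e by (rule entire_egfD[OF assms])
  have "((\<lambda>x. \<Sum>k. ?e k * x ^ k) has_field_derivative (\<Sum>k. diffs ?e k * x ^ k)) (at x)"
    by (rule termdiffs_strong_converges_everywhere[OF s])
  moreover have "diffs ?e k * x ^ k = - (c (Suc k) * (-x) ^ k / fact k)" for k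
    by (simp add: diffs_def power_minus[of x] del: of_nat_Suc)
  then have "(\<Sum>k. diffs ?e k * x ^ k) = - altexp (\<lambda>k. c (Suc k)) x"
    unfolding altexp_def using entire_egfD[OF entire_egf_Suc[OF assms], of "-x"]
    by (simp add: suminf_minus)
  ultimately show ?thesis
    by (simp only: altexp_def[abs_def] e)
qed

lemma altexp_0 [simp]: "altexp c 0 = c 0"
  unfolding altexp_def by (subst suminf_finite[of "{0}"]) (auto simp: power_0_left)

text \<open>
  Up to the sign \<open>(-1) ^ m\<close>, \<open>altexp\<close> of the sequence shifted by \<open>m\<close> is the \<open>m\<close>-th derivative of
  \<open>altexp c\<close>, so this is complete monotonicity of \<open>altexp c\<close> on \<open>[0, \<infinity>)\<close>. By Bernstein's theorem the
  sequences with this property and an entire generating function are moment sequences of positive measures on the half-line.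
\<close>

definition cm_seq :: "(nat \<Rightarrow> real) \<Rightarrow> bool" where
  "cm_seq c \<longleftrightarrow> (\<forall>m. \<forall>x\<ge>0. 0 \<le> altexp (\<lambda>k. c (k + m)) x)"

lemma cm_seqD: "cm_seq c \<Longrightarrow> 0 \<le> x \<Longrightarrow> 0 \<le> altexp (\<lambda>k. c (k + m)) x"
  by (simp add: cm_seq_def)

lemma cm_seq_shift: "cm_seq c \<Longrightarrow> cm_seq (\<lambda>k. c (k + m))"
  by (simp add: cm_seq_def add.assoc)

lemma cm_seq_nonneg: "cm_seq c \<Longrightarrow> 0 \<le> c m"
  using cm_seqD[of c 0 m] by simp

lemma cm_seq_altexp_le:
  assumes "entire_egf c" "cm_seq c" "0 \<le> x"
  shows "altexp c x \<le> c 0"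
proof -
  have "altexp c x \<le> altexp c 0"
  proof (rule DERIV_nonpos_imp_nonincreasing[OF \<open>0 \<le> x\<close>])
    fix y :: real assume "0 \<le> y"
    then show "\<exists>d. (altexp c has_real_derivative d) (at y) \<and> d \<le> 0"
      using altexp_deriv[OF assms(1)] cm_seqD[OF assms(2), of y 1] by fastforce
  qed
  then show ?thesis by simp
qed

text \<open>
  Taylor's formula with Lagrange remainder: the remainder is \<open>(- x) ^ K / K!\<close> times the \<open>K\<close>-th shifted
  function at an intermediate point, and that function is nonnegative and decreasing, hence at most its
  value \<open>c K\<close> at 0.
\<close>

lemma cm_seq_enveloping:
  assumes c: "entire_egf c" "cm_seq c" and "0 \<le> x"
  shows "\<bar>altexp c x - (\<Sum>k<K. c k * (-x) ^ k / fact k)\<bar> \<le> c K * x ^ K / fact K"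
proof (cases "x = 0 \<or> K = 0")
  case True
  show ?thesis
  proof (cases "K = 0")
    case True
    then show ?thesis
      using cm_seq_altexp_le[OF c \<open>0 \<le> x\<close>] cm_seqD[OF c(2) \<open>0 \<le> x\<close>, of 0] by simp
  next
    case False
    with True have "x = 0" by simp
    have "(\<Sum>k<K. c k * (-x) ^ k / fact k) = (\<Sum>k\<in>{0}. c k * (-x) ^ k / fact k)"
      using False \<open>x = 0\<close> by (intro sum.mono_neutral_right) (auto simp: power_0_left)
    then show ?thesis using \<open>x = 0\<close> False by (simp add: power_0_left)
  qed
next
  case False
  then have "0 < x" "0 < K" using \<open>0 \<le> x\<close> by auto
  define diff where "diff m y = (-1) ^ m * altexp (\<lambda>k. c (k + m)) y" for m y
  have "DERIV (diff m) y :> diff (Suc m) y" for m y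
  proof -
    have "(diff m has_field_derivative (-1) ^ m * - altexp (\<lambda>k. c (Suc k + m)) y) (at y)"
      unfolding diff_def[abs_def]
      using altexp_deriv[OF entire_egf_shift[OF c(1), of m], of y] by (intro DERIV_cmult) simp
    then show ?thesis by (simp add: diff_def)
  qed
  moreover have "diff 0 = altexp c" by (simp add: diff_def fun_eq_iff)
  ultimately obtain y where y: "0 < y" "y < x" and
    eq: "altexp c x = (\<Sum>m<K. (diff m 0 / fact m) * x ^ m) + (diff K y / fact K) * x ^ K"
    using Maclaurin[OF \<open>0 < x\<close> \<open>0 < K\<close>, of diff "altexp c"] by blast
  have "(diff m 0 / fact m) * x ^ m = c m * (-x) ^ m / fact m" for m
    by (simp add: diff_def power_minus[of x])
  then have "altexp c x - (\<Sum>k<K. c k * (-x) ^ k / fact k) = (diff K y / fact K) * x ^ K"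
    by (simp add: eq)
  moreover have "\<bar>diff K y\<bar> \<le> c K"
    using cm_seqD[OF c(2), of y K] y
      cm_seq_altexp_le[OF entire_egf_shift[OF c(1)] cm_seq_shift[OF c(2)], of y K]
    by (simp add: diff_def abs_mult)
  ultimately show ?thesis using \<open>0 < x\<close>
    by (simp add: abs_mult divide_right_mono mult_right_mono)
qed

lemma entire_egf_bounded:
  assumes "\<And>k. \<bar>c k\<bar> \<le> B"
  shows "entire_egf c"
  unfolding entire_egf_def
proof
  fix x :: real
  have "summable (\<lambda>k. B * (\<bar>x\<bar> ^ k / fact k))"
    using summable_exp[of "\<bar>x\<bar>"] by (intro summable_mult) (simp add: field_simps)
  then show "summable (\<lambda>k. c k * x ^ k / fact k)"
    by (rule summable_comparison_test'[of _ 0])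
       (auto simp: abs_mult power_abs intro!: divide_right_mono mult_right_mono assms)
qed

lemma cm_seq_const: "cm_seq (\<lambda>_. 1)"
proof -
  have "altexp (\<lambda>_. 1) x = exp (-x)" for x
    by (simp add: altexp_def exp_def field_simps scaleR_conv_of_real)
  then show ?thesis by (simp add: cm_seq_def)
qed

text \<open>
  In terms of measures this is the push-forward under \<open>u \<mapsto> a * u\<close>; here it is the substitution
  \<open>x \<mapsto> a * x\<close>.
\<close>

lemma cm_seq_scale:
  assumes "cm_seq c" "entire_egf c" "0 \<le> a"
  shows "cm_seq (\<lambda>k. a ^ k * c k)"
  unfolding cm_seq_def
proof (intro allI impI)
  fix m and x :: real assume "0 \<le> x"
  have eq: "a ^ (k + m) * c (k + m) * (-x) ^ k / fact k = a ^ m * (c (k + m) * (- (a * x)) ^ k / fact k)" for k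
    by (simp add: power_add power_minus[of x] power_minus[of "a * x"] power_mult_distrib)
  have "altexp (\<lambda>k. a ^ (k + m) * c (k + m)) x = (\<Sum>k. a ^ m * (c (k + m) * (- (a * x)) ^ k / fact k))"
    unfolding altexp_def eq ..
  also have "\<dots> = a ^ m * altexp (\<lambda>k. c (k + m)) (a * x)"
    unfolding altexp_def by (rule suminf_mult[OF entire_egfD[OF entire_egf_shift[OF assms(2)]]])
  finally have "altexp (\<lambda>k. a ^ (k + m) * c (k + m)) x = a ^ m * altexp (\<lambda>k. c (k + m)) (a * x)" .
  then show "0 \<le> altexp (\<lambda>k. a ^ (k + m) * c (k + m)) x"
    using assms \<open>0 \<le> x\<close> by (simp add: cm_seqD)
qed

lemma altexp_add:
  "entire_egf c \<Longrightarrow> entire_egf d \<Longrightarrow> altexp (\<lambda>k. a * c k + b * d k) x = a * altexp c x + b * altexp d x"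
proof -
  assume c: "entire_egf c" and d: "entire_egf d"
  have "(\<lambda>k. a * (c k * (-x) ^ k / fact k) + b * (d k * (-x) ^ k / fact k)) sums (a * altexp c x + b * altexp d x)"
    unfolding altexp_def by (intro sums_add sums_mult summable_sums entire_egfD c d)
  moreover have "a * (c k * (-x) ^ k / fact k) + b * (d k * (-x) ^ k / fact k)
      = (a * c k + b * d k) * (-x) ^ k / fact k" for k
    by (simp add: distrib_right add_divide_distrib)
  ultimately show ?thesis
    unfolding altexp_def by (simp add: sums_iff)
qed

text \<open>
  The factor \<open>j / (k + j)\<close> is the \<open>k\<close>-th moment of the density \<open>j * u ^ (j - 1)\<close> on \<open>[0, 1]\<close>, so the new
  function is an average of rescalings of the old one. Without integrals: the
  \<open>m\<close>-th shift of the new function, multiplied by \<open>x ^ (j + m)\<close>, has derivative \<open>j * x ^ (j + m - 1)\<close> times the \<open>m\<close>-th shift of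
  the old function, which is nonnegative, and the product vanishes at 0.
\<close>

lemma cm_seq_beta:
  assumes c: "cm_seq c" "entire_egf c" and d: "entire_egf (\<lambda>k. c k * (j / (real k + j)))" and "1 \<le> j"
  shows "cm_seq (\<lambda>k. c k * (real j / (real k + real j)))"
  unfolding cm_seq_def
proof (intro allI impI)
  fix m and x :: real assume "0 \<le> x"
  define d where "d k = c (k + m) * (real j / (real (k + m) + real j))" for k
  define p where "p = j + m"
  have p: "1 \<le> p" using \<open>1 \<le> j\<close> by (simp add: p_def)
  have d': "entire_egf d"
    unfolding d_def using entire_egf_shift[OF d, of m] by simp
  \<comment> \<open>Termwise: the left-hand side multiplies \<open>d k\<close> by \<open>k + p\<close>, which cancels the denominator of \<open>d\<close>.\<close>
  have key: "real p * altexp d y - y * altexp (\<lambda>k. d (Suc k)) y = j * altexp (\<lambda>k. c (k + m)) y" for y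
  proof -
    have s1: "(\<lambda>k. d k * (-y) ^ k / fact k) sums altexp d y"
      unfolding altexp_def by (intro summable_sums entire_egfD d')
    have s2: "(\<lambda>k. d (Suc k) * (-y) ^ k / fact k) sums altexp (\<lambda>k. d (Suc k)) y"
      unfolding altexp_def by (intro summable_sums entire_egfD entire_egf_Suc d')
    have "(\<lambda>k. -y * (d (Suc k) * (-y) ^ k / fact k)) sums (-y * altexp (\<lambda>k. d (Suc k)) y)"
      by (rule sums_mult[OF s2])
    also have "(\<lambda>k. -y * (d (Suc k) * (-y) ^ k / fact k)) =
        (\<lambda>k. real (Suc k) * (d (Suc k) * (-y) ^ Suc k / fact (Suc k)))"
      by (simp add: fun_eq_iff del: of_nat_Suc)
    finally have "(\<lambda>k. real k * (d k * (-y) ^ k / fact k)) sums (-y * altexp (\<lambda>k. d (Suc k)) y)"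
      by (subst (asm) sums_Suc_iff) simp
    from sums_add[OF this sums_mult[OF s1, of "real p"]]
    have "(\<lambda>k. (real k + real p) * (d k * (-y) ^ k / fact k)) sums
        (-y * altexp (\<lambda>k. d (Suc k)) y + real p * altexp d y)"
      by (simp only: distrib_right)
    moreover have dk: "(real k + real p) * d k = j * c (k + m)" for k
    proof -
      have "real k + real p = real (k + m) + real j" by (simp add: p_def)
      moreover have "real (k + m) + real j \<noteq> 0" using \<open>1 \<le> j\<close> by simp
      then have "(real (k + m) + real j) * d k = j * c (k + m)"
        unfolding d_def by (simp del: of_nat_add)
      ultimately show ?thesis by (simp only:)
    qed
    have "(real k + real p) * (d k * (-y) ^ k / fact k) = j * (c (k + m) * (-y) ^ k / fact k)" for k
    proof -
      have "(real k + real p) * (d k * (-y) ^ k / fact k) = ((real k + real p) * d k) * (-y) ^ k / fact k"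
        by (simp only: times_divide_eq_right mult.assoc)
      then show ?thesis unfolding dk by (simp only: times_divide_eq_right mult.assoc)
    qed
    ultimately have "(\<lambda>k. j * (c (k + m) * (-y) ^ k / fact k)) sums
        (-y * altexp (\<lambda>k. d (Suc k)) y + real p * altexp d y)" by (simp only:)
    moreover have "(\<lambda>k. j * (c (k + m) * (-y) ^ k / fact k)) sums (j * altexp (\<lambda>k. c (k + m)) y)"
      unfolding altexp_def by (intro sums_mult summable_sums entire_egfD entire_egf_shift c)
    ultimately have "-y * altexp (\<lambda>k. d (Suc k)) y + real p * altexp d y = j * altexp (\<lambda>k. c (k + m)) y"
      by (rule sums_unique2)
    then show ?thesis by simp
  qed
  have "0 ^ p * altexp d 0 \<le> x ^ p * altexp d x"
  proof (rule DERIV_nonneg_imp_nondecreasing[OF \<open>0 \<le> x\<close>])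
    fix y :: real assume "0 \<le> y" "y \<le> x"
    have "((\<lambda>y. y ^ p * altexp d y) has_real_derivative
        real p * y ^ (p - Suc 0) * altexp d y + - altexp (\<lambda>k. d (Suc k)) y * y ^ p) (at y)"
      by (intro DERIV_mult DERIV_pow altexp_deriv[OF d'])
    moreover have "y ^ p = y ^ (p - 1) * y" using p by (cases p) auto
    then have "real p * y ^ (p - Suc 0) * altexp d y + - altexp (\<lambda>k. d (Suc k)) y * y ^ p =
        y ^ (p - 1) * (real p * altexp d y - y * altexp (\<lambda>k. d (Suc k)) y)"
      by (simp add: algebra_simps)
    moreover have "\<dots> \<ge> 0" unfolding key using \<open>0 \<le> y\<close> cm_seqD[OF c(1)] by simp
    ultimately show "\<exists>D. ((\<lambda>y. y ^ p * altexp d y) has_real_derivative D) (at y) \<and> 0 \<le> D" by auto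
  qed
  moreover have "(0::real) ^ p = 0" using p by (simp add: power_0_left)
  ultimately have "0 \<le> x ^ p * altexp d x" by (simp only: mult_zero_left)
  then have "0 \<le> altexp d x"
  proof (cases "x = 0")
    case True
    then show ?thesis using cm_seq_nonneg[OF c(1), of m] by (simp add: d_def)
  next
    case False
    with \<open>0 \<le> x\<close> have "0 < x ^ p" by simp
    from mult_le_cancel_left_pos[OF this, of 0 "altexp d x"] \<open>0 \<le> x ^ p * altexp d x\<close>
    show ?thesis by (simp only: mult_zero_right)
  qed
  then show "0 \<le> altexp (\<lambda>k. c (k + m) * (real j / (real (k + m) + real j))) x"
    unfolding d_def .
qed

text \<open>
  Termwise expectation of a Taylor series that need not converge absolutely in mean. By
  \<open>cm_seq_enveloping\<close> the \<open>K\<close>-th partial sum differs from \<open>Z ^ r * altexp c Z\<close> pointwise by at most the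
  absolute value of term \<open>K\<close>; term \<open>K\<close> has a constant sign, so after integration the bound is the
  absolute value of its expectation, which is a null sequence by assumption.
\<close>

lemma (in prob_space) expectation_altexp_sums:
  assumes c: "entire_egf c" "cm_seq c"
    and Z[measurable]: "Z \<in> borel_measurable M" and nonneg: "AE \<omega> in M. 0 \<le> Z \<omega>"
    and moments: "\<And>k. integrable M (\<lambda>\<omega>. Z \<omega> ^ k)"
    and null: "(\<lambda>k. c k * (-1) ^ k * expectation (\<lambda>\<omega>. Z \<omega> ^ (r + k)) / fact k) \<longlonglongrightarrow> 0"
  shows "integrable M (\<lambda>\<omega>. Z \<omega> ^ r * altexp c (Z \<omega>))"
    and "(\<lambda>k. c k * (-1) ^ k * expectation (\<lambda>\<omega>. Z \<omega> ^ (r + k)) / fact k)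
      sums expectation (\<lambda>\<omega>. Z \<omega> ^ r * altexp c (Z \<omega>))"
proof -
  have [measurable]: "altexp c \<in> borel_measurable borel"
    unfolding altexp_def[abs_def] by measurable
  show int: "integrable M (\<lambda>\<omega>. Z \<omega> ^ r * altexp c (Z \<omega>))"
  proof (rule Bochner_Integration.integrable_bound)
    show "integrable M (\<lambda>\<omega>. c 0 * Z \<omega> ^ r)" by (intro integrable_mult_right moments)
    show "AE \<omega> in M. norm (Z \<omega> ^ r * altexp c (Z \<omega>)) \<le> norm (c 0 * Z \<omega> ^ r)"
      using nonneg
    proof eventually_elim
      case (elim \<omega>)
      then show ?case
        using cm_seq_enveloping[OF c elim, of 0] cm_seq_nonneg[OF c(2), of 0]
        by (simp add: abs_mult mult.commute[of "c 0"] mult_left_mono)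
    qed
  qed measurable
  let ?t = "\<lambda>k. c k * (-1) ^ k * expectation (\<lambda>\<omega>. Z \<omega> ^ (r + k)) / fact k"
  let ?p = "\<lambda>K \<omega>. \<Sum>k<K. c k * (-1) ^ k / fact k * Z \<omega> ^ (r + k)"
  have p_int: "integrable M (?p K)" for K
    by (intro Bochner_Integration.integrable_sum integrable_mult_right moments)
  have p_exp: "expectation (?p K) = (\<Sum>k<K. ?t k)" for K
  proof -
    have "expectation (?p K) = (\<Sum>k<K. expectation (\<lambda>\<omega>. c k * (-1) ^ k / fact k * Z \<omega> ^ (r + k)))"
      by (rule Bochner_Integration.integral_sum) (intro integrable_mult_right moments)
    also have "\<dots> = (\<Sum>k<K. ?t k)"
      by (intro sum.cong refl) simp
    finally show ?thesis .
  qed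
  have "\<bar>(\<Sum>k<K. ?t k) - expectation (\<lambda>\<omega>. Z \<omega> ^ r * altexp c (Z \<omega>))\<bar> \<le> \<bar>?t K\<bar>" for K
  proof -
    let ?e = "\<lambda>\<omega>. c K / fact K * Z \<omega> ^ (r + K)"
    have e_int: "integrable M ?e" by (intro integrable_mult_right moments)
    have diff_int: "integrable M (\<lambda>\<omega>. ?p K \<omega> - Z \<omega> ^ r * altexp c (Z \<omega>))"
      by (intro Bochner_Integration.integrable_diff p_int int)
    have bound: "AE \<omega> in M. \<bar>?p K \<omega> - Z \<omega> ^ r * altexp c (Z \<omega>)\<bar> \<le> ?e \<omega>"
      using nonneg
    proof eventually_elim
      case (elim \<omega>)
      have "c k * (-1) ^ k / fact k * Z \<omega> ^ (r + k) = Z \<omega> ^ r * (c k * (- Z \<omega>) ^ k / fact k)" for k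
        by (simp add: power_add power_minus[of "Z \<omega>"])
      then have "?p K \<omega> = Z \<omega> ^ r * (\<Sum>k<K. c k * (- Z \<omega>) ^ k / fact k)"
        by (simp only: sum_distrib_left)
      then have "\<bar>?p K \<omega> - Z \<omega> ^ r * altexp c (Z \<omega>)\<bar> =
          Z \<omega> ^ r * \<bar>altexp c (Z \<omega>) - (\<Sum>k<K. c k * (- Z \<omega>) ^ k / fact k)\<bar>"
        using elim by (simp add: abs_mult abs_minus_commute flip: right_diff_distrib)
      also have "\<dots> \<le> Z \<omega> ^ r * (c K * Z \<omega> ^ K / fact K)"
        using elim by (intro mult_left_mono cm_seq_enveloping c) auto
      also have "\<dots> = ?e \<omega>" by (simp add: power_add)
      finally show ?case .
    qed
    have "\<bar>expectation (\<lambda>\<omega>. ?p K \<omega> - Z \<omega> ^ r * altexp c (Z \<omega>))\<bar>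
        \<le> expectation (\<lambda>\<omega>. \<bar>?p K \<omega> - Z \<omega> ^ r * altexp c (Z \<omega>)\<bar>)"
      by (rule integral_abs_bound)
    also have "\<dots> \<le> expectation ?e"
      by (intro integral_mono_AE integrable_abs diff_int e_int bound)
    also have "\<dots> \<le> \<bar>?t K\<bar>"
    proof -
      have "expectation ?e = c K / fact K * expectation (\<lambda>\<omega>. Z \<omega> ^ (r + K))" by simp
      moreover have "?t K = (-1) ^ K * (c K / fact K * expectation (\<lambda>\<omega>. Z \<omega> ^ (r + K)))" by simp
      ultimately have "?t K = (-1) ^ K * expectation ?e" by (simp only:)
      then have "\<bar>?t K\<bar> = \<bar>expectation ?e\<bar>"
        by (simp only: abs_mult power_abs abs_minus_cancel abs_one power_one mult_1_left)
      then show ?thesis by linarith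
    qed
    finally show ?thesis
      by (simp only: Bochner_Integration.integral_diff[OF p_int int] p_exp)
  qed
  then have "\<forall>\<^sub>F K in sequentially. norm ((\<Sum>k<K. ?t k) - expectation (\<lambda>\<omega>. Z \<omega> ^ r * altexp c (Z \<omega>))) \<le> \<bar>?t K\<bar>"
    by (simp only: real_norm_def eventually_True)
  then have "(\<lambda>K. (\<Sum>k<K. ?t k) - expectation (\<lambda>\<omega>. Z \<omega> ^ r * altexp c (Z \<omega>))) \<longlonglongrightarrow> 0"
    by (rule Lim_null_comparison) (rule tendsto_rabs_zero[OF null])
  then show "?t sums expectation (\<lambda>\<omega>. Z \<omega> ^ r * altexp c (Z \<omega>))"
    unfolding sums_def by (rule LIM_zero_cancel)
qed

section \<open>Complete monotonicity of the Mittag-Leffler function\<close>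

text \<open>
  The Gamma integral over \<open>[A, A + 1]\<close> alone already gives this. Since \<open>A\<close> is arbitrary, \<open>\<Gamma>\<close> grows faster
  than every exponential, which is all that the convergence of the series below requires.
\<close>

lemma Gamma_real_ge:
  assumes "1 \<le> z" "0 < A"
  shows "A powr (z - 1) / exp (A + 1) \<le> Gamma (z::real)"
proof -
  define c where "c = A powr (z - 1) / exp (A + 1)"
  have h1: "((\<lambda>t. t powr (z - 1) / exp t) has_integral Gamma z) {0..}"
    using assms by (intro Gamma_integral_real) auto
  have h2: "((\<lambda>t. if t \<in> {A..A+1} then c else 0) has_integral c) {0..}"
  proof (rule iffD2[OF has_integral_restrict])
    show "{A..A+1} \<subseteq> {0..}" using \<open>0 < A\<close> by auto
    show "((\<lambda>t. c) has_integral c) {A..A+1}"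
      using has_integral_const_real[of c A "A + 1"] by simp
  qed
  have le: "(if t \<in> {A..A+1} then c else 0) \<le> t powr (z - 1) / exp t" for t
  proof (cases "t \<in> {A..A+1}")
    case True
    then have "A powr (z - 1) \<le> t powr (z - 1)" "exp t \<le> exp (A + 1)"
      using assms by (auto intro: powr_mono2)
    then have "c \<le> t powr (z - 1) / exp t"
      unfolding c_def by (intro frac_le) auto
    with True show ?thesis by simp
  next
    case False
    then show ?thesis by (simp only: if_False) simp
  qed
  show ?thesis
    using has_integral_le[OF h2 h1 le] by (simp only: c_def)
qed

lemma summable_power_over_Gamma:
  assumes "0 < \<alpha>" "0 < \<beta>"
  shows "summable (\<lambda>k. x ^ k / Gamma (\<alpha> * real k + \<beta>))"
proof -
  \<comment> \<open>Chosen so that \<open>\<bar>x\<bar> ^ k\<close> divided by \<open>A powr (\<alpha> * k)\<close> is at most \<open>(1 / 2) ^ k\<close>.\<close>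
  define A where "A = (2 * \<bar>x\<bar> + 1) powr (1 / \<alpha>)"
  have A: "0 < A" "A powr \<alpha> = 2 * \<bar>x\<bar> + 1"
    using assms by (simp_all add: A_def powr_powr)
  define C where "C = exp (A + 1) * A powr (1 - \<beta>)"
  show ?thesis
  proof (rule summable_comparison_test_ev)
    show "summable (\<lambda>k. C * (1 / 2) ^ k :: real)"
      by (intro summable_mult summable_geometric) simp
    have "\<forall>\<^sub>F k in sequentially. 1 / \<alpha> \<le> real k"
      using filterlim_real_sequentially unfolding filterlim_at_top by blast
    then show "\<forall>\<^sub>F k in sequentially. norm (x ^ k / Gamma (\<alpha> * real k + \<beta>)) \<le> C * (1 / 2) ^ k"
    proof eventually_elim
      case (elim k)
      then have z: "1 \<le> \<alpha> * real k + \<beta>"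
        using assms by (simp add: field_simps)
      have "A powr (\<alpha> * real k + \<beta> - 1) = (A powr \<alpha>) ^ k * A powr (\<beta> - 1)"
        using A(1) by (simp add: powr_add powr_diff powr_powr mult.commute flip: powr_realpow)
      then have g: "(A powr \<alpha>) ^ k / C \<le> Gamma (\<alpha> * real k + \<beta>)"
        using Gamma_real_ge[OF z A(1)] A(1) by (simp add: C_def powr_diff field_simps)
      have C: "0 < C" "0 < (A powr \<alpha>) ^ k" using A(1) by (auto simp: C_def)
      have "norm (x ^ k / Gamma (\<alpha> * real k + \<beta>)) = \<bar>x\<bar> ^ k / Gamma (\<alpha> * real k + \<beta>)"
        using Gamma_real_pos[of "\<alpha> * real k + \<beta>"] z by (simp add: power_abs)
      also have "\<dots> \<le> \<bar>x\<bar> ^ k / ((A powr \<alpha>) ^ k / C)"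
        using g C by (intro divide_left_mono mult_pos_pos divide_pos_pos Gamma_real_pos) (use z in auto)
      also have "\<dots> = C * (\<bar>x\<bar> / (2 * \<bar>x\<bar> + 1)) ^ k"
        unfolding A(2) by (simp add: power_divide)
      also have "\<dots> \<le> C * (1 / 2) ^ k"
        using C by (intro mult_left_mono power_mono) (auto simp: field_simps)
      finally show ?case .
    qed
  qed
qed

definition euler_prod :: "real \<Rightarrow> nat \<Rightarrow> nat \<Rightarrow> real" where
  "euler_prod \<alpha> N k = (\<Prod>i<N. (\<alpha> * real k + real (Suc i)) / (real k + real (Suc i)))"

lemma euler_prod_bounds:
  assumes "0 \<le> \<alpha>" "\<alpha> \<le> 1"
  shows "0 \<le> euler_prod \<alpha> N k" "euler_prod \<alpha> N k \<le> 1"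
proof -
  have "\<alpha> * real k \<le> real k" using mult_right_mono[OF assms(2), of "real k"] by simp
  then show "0 \<le> euler_prod \<alpha> N k" "euler_prod \<alpha> N k \<le> 1"
    unfolding euler_prod_def using assms
    by (auto intro!: prod_nonneg prod_le_1 divide_nonneg_nonneg add_nonneg_nonneg simp: divide_le_eq_1)
qed

text \<open>
  Each new factor equals \<open>\<alpha> + (1 - \<alpha>) * (j / (k + j))\<close>, a convex combination of the identity and the
  operation of \<open>cm_seq_beta\<close>.
\<close>

lemma cm_seq_euler_prod:
  assumes "0 \<le> \<alpha>" "\<alpha> \<le> 1"
  shows "cm_seq (euler_prod \<alpha> N)"
proof (induction N)
  case 0
  then show ?case by (simp add: euler_prod_def cm_seq_const)
next
  case (Suc N)
  let ?c = "euler_prod \<alpha> N" and ?j = "Suc N"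
  let ?d = "\<lambda>k. ?c k * (real ?j / (real k + real ?j))"
  have c: "entire_egf ?c"
    using euler_prod_bounds[OF assms, of N] by (intro entire_egf_bounded[of _ 1]) auto
  have "0 \<le> ?d k \<and> ?d k \<le> 1" for k
  proof
    show "0 \<le> ?d k"
      using euler_prod_bounds[OF assms, of N k] by simp
    show "?d k \<le> 1"
      using euler_prod_bounds[OF assms, of N k] by (intro mult_le_one) (auto simp: divide_le_eq_1)
  qed
  then have d: "entire_egf ?d"
    by (intro entire_egf_bounded[of _ 1]) (simp only: abs_of_nonneg)
  have cm: "cm_seq ?d"
    by (rule cm_seq_beta[OF Suc c d]) simp
  have "(\<alpha> * real k + ?j) / (real k + ?j) = \<alpha> + (1 - \<alpha>) * (real ?j / (real k + real ?j))" for k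
    by (simp add: field_simps)
  then have eq: "euler_prod \<alpha> (Suc N) = (\<lambda>k. \<alpha> * ?c k + (1 - \<alpha>) * ?d k)"
    by (auto simp: euler_prod_def fun_eq_iff algebra_simps simp del: of_nat_Suc)
  show ?case
    unfolding cm_seq_def eq
  proof (intro allI impI)
    fix m and x :: real assume "0 \<le> x"
    have "altexp (\<lambda>k. \<alpha> * ?c (k + m) + (1 - \<alpha>) * ?d (k + m)) x =
      \<alpha> * altexp (\<lambda>k. ?c (k + m)) x + (1 - \<alpha>) * altexp (\<lambda>k. ?d (k + m)) x"
      by (rule altexp_add[OF entire_egf_shift[OF c] entire_egf_shift[OF d]])
    also have "\<dots> \<ge> 0"
      using assms cm_seqD[OF Suc \<open>0 \<le> x\<close>] cm_seqD[OF cm \<open>0 \<le> x\<close>]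
      by (intro add_nonneg_nonneg mult_nonneg_nonneg) auto
    finally show "0 \<le> altexp (\<lambda>k. \<alpha> * ?c (k + m) + (1 - \<alpha>) * ?d (k + m)) x" .
  qed
qed

text \<open>
  With these coefficients \<open>altexp\<close> is the Mittag-Leffler function \<open>E\<^sub>\<alpha>\<close> at \<open>- x\<close>.
\<close>

definition ml_coeff :: "real \<Rightarrow> nat \<Rightarrow> real" where
  "ml_coeff \<alpha> k = fact k / Gamma (\<alpha> * real k + 1)"

text \<open>
  Gauss's approximation to \<open>k! / \<Gamma>(\<alpha> * k + 1)\<close>. The exponents \<open>k + 1\<close> and \<open>\<alpha> * k + 1\<close> of
  \<open>Gamma_series\<close> leave \<open>(1 - \<alpha>) * k\<close>, and its Pochhammer symbols at index \<open>n + 1\<close> have \<open>n + 2\<close> factors.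
\<close>

definition euler_approx :: "real \<Rightarrow> nat \<Rightarrow> nat \<Rightarrow> real" where
  "euler_approx \<alpha> n k = (real (Suc n) powr (1 - \<alpha>)) ^ k * euler_prod \<alpha> (Suc (Suc n)) k"

lemma entire_euler_prod:
  assumes "0 \<le> \<alpha>" "\<alpha> \<le> 1"
  shows "entire_egf (euler_prod \<alpha> N)"
proof (rule entire_egf_bounded)
  show "\<bar>euler_prod \<alpha> N k\<bar> \<le> 1" for k
    using euler_prod_bounds[OF assms, of N k] by simp
qed

lemma cm_seq_euler_approx:
  assumes "0 \<le> \<alpha>" "\<alpha> \<le> 1"
  shows "cm_seq (euler_approx \<alpha> n)"
proof -
  have "euler_approx \<alpha> n = (\<lambda>k. (real (Suc n) powr (1 - \<alpha>)) ^ k * euler_prod \<alpha> (Suc (Suc n)) k)"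
    by (simp only: euler_approx_def[abs_def])
  then show ?thesis
    using cm_seq_scale[OF cm_seq_euler_prod[OF assms] entire_euler_prod[OF assms] powr_ge_zero]
    by (simp only:)
qed

lemma euler_approx_LIMSEQ:
  assumes "0 < \<alpha>"
  shows "(\<lambda>n. euler_approx \<alpha> n k) \<longlonglongrightarrow> ml_coeff \<alpha> k"
proof -
  have pos: "0 < Gamma (\<alpha> * real k + 1)"
    using assms by (intro Gamma_real_pos) (simp add: add_nonneg_pos)
  have "(\<lambda>n. Gamma_series (real k + 1) (Suc n) / Gamma_series (\<alpha> * real k + 1) (Suc n)) \<longlonglongrightarrow>
      Gamma (real k + 1) / Gamma (\<alpha> * real k + 1)"
    using pos by (intro tendsto_divide LIMSEQ_Suc Gamma_series_LIMSEQ) auto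
  moreover have "Gamma_series (real k + 1) (Suc n) / Gamma_series (\<alpha> * real k + 1) (Suc n) = euler_approx \<alpha> n k" for n
  proof -
    define L where "L = ln (real (Suc n))"
    let ?P = "\<lambda>z. pochhammer z (Suc (Suc n)) :: real"
    have series: "Gamma_series z (Suc n) = fact (Suc n) * exp (z * L) / ?P z" for z
      by (simp only: Gamma_series_def L_def Suc_eq_plus1 of_real_eq_id id_apply)
    have "(real (Suc n) powr (1 - \<alpha>)) ^ k = exp (real k * ((1 - \<alpha>) * L))"
      unfolding exp_of_nat_mult L_def powr_def by simp
    also have "real k * ((1 - \<alpha>) * L) = (real k + 1) * L - (\<alpha> * real k + 1) * L"
      by (simp add: algebra_simps)
    finally have pw: "(real (Suc n) powr (1 - \<alpha>)) ^ k = exp ((real k + 1) * L) / exp ((\<alpha> * real k + 1) * L)"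
      by (simp only: exp_diff)
    have pr: "euler_prod \<alpha> (Suc (Suc n)) k = ?P (\<alpha> * real k + 1) / ?P (real k + 1)"
      unfolding euler_prod_def pochhammer_prod prod_dividef lessThan_atLeast0 by (simp only: of_nat_Suc ac_simps)
    show ?thesis
      unfolding euler_approx_def pw pr series by (simp del: fact_Suc)
  qed
  moreover have "Gamma (real k + 1) = fact k"
    using Gamma_fact[of k, where ?'a = real] by (simp add: add.commute)
  ultimately show ?thesis by (simp add: ml_coeff_def)
qed

text \<open>
  Monotonicity makes the limit itself a majorant, as needed to pass to the limit under the sum.
  With \<open>u = \<alpha> * k\<close>, \<open>d = (1 - \<alpha>) * k\<close>, \<open>a = n + 1\<close>, \<open>b = n + 2\<close> and \<open>N = n + 3\<close>, the new factor \<open>(u + N) / (u + d + N)\<close> of the product is at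
  least \<open>exp (- d / N)\<close>, and this is compensated by the growth of the power, because
  \<open>1 / N \<le> ln (b / a)\<close>.
\<close>

lemma euler_approx_mono:
  assumes "0 < \<alpha>" "\<alpha> \<le> 1"
  shows "euler_approx \<alpha> n k \<le> euler_approx \<alpha> (Suc n) k"
proof -
  define a b N where "a = real (Suc n)" and "b = a + 1" and "N = b + 1"
  have ab: "0 < a" "0 < b" "0 < N" by (simp_all add: a_def b_def N_def)
  have Suc_n: "real (Suc (Suc n)) = b" "real (Suc (Suc (Suc n))) = N"
    by (simp_all add: a_def b_def N_def)
  define u where "u = \<alpha> * real k"
  define d where "d = (1 - \<alpha>) * real k"
  have u: "0 \<le> u" and d: "0 \<le> d" and k: "real k = u + d"
    using assms mult_right_mono[of \<alpha> 1 "real k"] by (simp_all add: u_def d_def algebra_simps)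
  have "ln (a / b) \<le> a / b - 1"
    using ab by (intro ln_le_minus_one) simp
  moreover have "a / b - 1 = - (1 / b)" using ab by (simp add: b_def field_simps)
  moreover have "ln (a / b) = - ln (b / a)" using ab by (simp add: ln_div)
  moreover have "1 / N \<le> 1 / b" using ab by (intro divide_left_mono) (auto simp: N_def)
  ultimately have ln: "1 / N \<le> ln (b / a)" by linarith
  have "u * d / N \<ge> 0" using u d ab by simp
  moreover have "(u + N) * (1 + d / N) = u + d + N + u * d / N"
    using ab by (simp add: field_simps)
  ultimately have "u + d + N \<le> (u + N) * (1 + d / N)" by linarith
  also have "\<dots> \<le> (u + N) * exp (d / N)"
    using u ab by (intro mult_left_mono exp_ge_add_one_self) auto
  also have "\<dots> \<le> (u + N) * exp (d * ln (b / a))"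
    using u ab mult_left_mono[OF ln d] by (intro mult_left_mono) auto
  also have "exp (d * ln (b / a)) = (b powr (1 - \<alpha>)) ^ k / (a powr (1 - \<alpha>)) ^ k"
    using ab by (simp add: powr_def ln_div d_def algebra_simps flip: exp_of_nat_mult exp_diff)
  finally have "(u + d + N) * (a powr (1 - \<alpha>)) ^ k \<le> (u + N) * (b powr (1 - \<alpha>)) ^ k"
    using ab by (simp add: pos_le_divide_eq)
  then have "(a powr (1 - \<alpha>)) ^ k \<le> (b powr (1 - \<alpha>)) ^ k * ((u + N) / (u + d + N))"
    using ab u d by (simp add: pos_le_divide_eq mult.commute)
  then have "(a powr (1 - \<alpha>)) ^ k * euler_prod \<alpha> (Suc (Suc n)) k \<le>
      (b powr (1 - \<alpha>)) ^ k * ((u + N) / (u + d + N)) * euler_prod \<alpha> (Suc (Suc n)) k"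
    using euler_prod_bounds(1)[of \<alpha>] assms by (intro mult_right_mono) auto
  moreover have "euler_prod \<alpha> (Suc (Suc (Suc n))) k = euler_prod \<alpha> (Suc (Suc n)) k * ((u + N) / (u + d + N))"
    unfolding k[symmetric] unfolding u_def euler_prod_def prod.lessThan_Suc[of _ "Suc (Suc n)"] Suc_n ..
  ultimately show ?thesis
    unfolding euler_approx_def Suc_n a_def[symmetric] by (simp only: mult_ac)
qed

lemma euler_approx_le:
  assumes "0 < \<alpha>" "\<alpha> \<le> 1"
  shows "euler_approx \<alpha> n k \<le> ml_coeff \<alpha> k"
proof (rule incseq_le[where X = "\<lambda>n. euler_approx \<alpha> n k"])
  show "incseq (\<lambda>n. euler_approx \<alpha> n k)"
    by (rule incseq_SucI) (rule euler_approx_mono[OF assms])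
qed (rule euler_approx_LIMSEQ[OF assms(1)])

lemma entire_ml_coeff:
  assumes "0 < \<alpha>"
  shows "entire_egf (ml_coeff \<alpha>)"
proof -
  have "ml_coeff \<alpha> k * x ^ k / fact k = x ^ k / Gamma (\<alpha> * real k + 1)" for k and x :: real
    by (simp add: ml_coeff_def)
  then show ?thesis
    using summable_power_over_Gamma[OF assms, of 1] by (simp add: entire_egf_def)
qed

text \<open>
  Pollard's theorem for the Mittag-Leffler function. Nonnegativity passes to the limit in
  \<open>euler_approx\<close> by Tannery's theorem, with the coefficients of the limit as majorants.
\<close>

lemma cm_seq_ml_coeff:
  assumes "0 < \<alpha>" "\<alpha> \<le> 1"
  shows "cm_seq (ml_coeff \<alpha>)"
  unfolding cm_seq_def
proof (intro allI impI)
  fix m and x :: real assume "0 \<le> x"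
  have approx_nonneg: "0 \<le> euler_approx \<alpha> n k" for n k
    using cm_seq_nonneg[OF cm_seq_euler_approx] assms by simp
  have bound: "norm (euler_approx \<alpha> n (k + m) * (-x) ^ k / fact k) \<le> ml_coeff \<alpha> (k + m) * x ^ k / fact k" for n k
    using euler_approx_le[OF assms, of n "k + m"] approx_nonneg[of n "k + m"] \<open>0 \<le> x\<close>
    by (auto simp: abs_mult power_abs intro!: divide_right_mono mult_right_mono)
  have "(\<lambda>n. altexp (\<lambda>k. euler_approx \<alpha> n (k + m)) x) \<longlonglongrightarrow> altexp (\<lambda>k. ml_coeff \<alpha> (k + m)) x"
    unfolding altexp_def
  proof (rule conjunct2[OF conjunct2[OF tannerys_theorem]])
    show "(\<lambda>n. euler_approx \<alpha> n (k + m) * (- x) ^ k / fact k) \<longlonglongrightarrow> ml_coeff \<alpha> (k + m) * (- x) ^ k / fact k" for k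
      by (intro tendsto_intros euler_approx_LIMSEQ assms) simp
    show "\<forall>\<^sub>F (k, n) in at_top \<times>\<^sub>F sequentially.
        norm (euler_approx \<alpha> n (k + m) * (- x) ^ k / fact k) \<le> ml_coeff \<alpha> (k + m) * x ^ k / fact k"
      using bound by (intro always_eventually) auto
    show "summable (\<lambda>k. ml_coeff \<alpha> (k + m) * x ^ k / fact k)"
      by (intro entire_egfD entire_egf_shift entire_ml_coeff assms)
  qed simp
  then show "0 \<le> altexp (\<lambda>k. ml_coeff \<alpha> (k + m)) x"
  proof (rule LIMSEQ_le_const)
    show "\<exists>N. \<forall>n\<ge>N. 0 \<le> altexp (\<lambda>k. euler_approx \<alpha> n (k + m)) x"
      using cm_seqD[OF cm_seq_euler_approx \<open>0 \<le> x\<close>] assms by simp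
  qed
qed

section \<open>Distribution functions of sums of Mittag-Leffler waiting times\<close>

text \<open>
  At \<open>x = lam * t powr \<alpha>\<close> this is the distribution function at \<open>t\<close> of a sum of \<open>r\<close> independent Mittag-Leffler
  waiting times. Its Laplace transform is \<open>(lam / (lam + s\<^sup>\<alpha>)) ^ r / s\<close>; expanding the binomial in powers of
  \<open>lam / s\<^sup>\<alpha>\<close> gives the generalized binomial coefficients. For \<open>\<alpha> = 1\<close> it is the Erlang distribution
  function.
\<close>

definition ml_erlang :: "real \<Rightarrow> nat \<Rightarrow> real \<Rightarrow> real" where
  "ml_erlang \<alpha> r x = (\<Sum>j. (- real r gchoose j) * (x ^ (r + j) / Gamma (\<alpha> * real (r + j) + 1)))"

lemma neg_gbinomial_Suc: "(- real (Suc p) gchoose k) = (-1) ^ k * real ((p + k) choose k)"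
proof -
  have "real (Suc p) + real k - 1 = real (p + k)" by simp
  then show ?thesis
    by (simp only: gbinomial_minus binomial_gbinomial)
qed

text \<open>
  The coefficients alternate in sign, so Vandermonde's identity also holds for their absolute values;
  this turns the identity into the majorant of the Cauchy product in \<open>ml_erlang_convolution\<close>.
\<close>

lemma abs_neg_gbinomial: "\<bar>- real r gchoose k\<bar> = (-1) ^ k * (- real r gchoose k)"
proof (cases r)
  case 0
  then show ?thesis by (cases k) simp_all
next
  case (Suc p)
  have "(-1::real) ^ k * ((-1) ^ k * y) = y" for y
    by (simp flip: mult.assoc power_mult_distrib)
  then show ?thesis unfolding Suc neg_gbinomial_Suc by (simp add: abs_mult)
qed

lemma abs_neg_gbinomial_le: "\<bar>- real r gchoose k\<bar> \<le> 2 ^ (r + k)"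
proof (cases r)
  case 0
  then show ?thesis by (cases k) simp_all
next
  case (Suc p)
  have "real ((p + k) choose k) \<le> 2 ^ (p + k)"
    using binomial_le_pow2[of "p + k" k] by (metis of_nat_le_iff of_nat_numeral of_nat_power)
  also have "\<dots> \<le> 2 ^ (Suc p + k)" by simp
  finally show ?thesis
    unfolding Suc neg_gbinomial_Suc abs_mult power_abs by simp
qed

lemma summable_neg_gbinomial_over_Gamma:
  assumes "0 < \<alpha>" "0 < \<beta>"
  shows "summable (\<lambda>j. \<bar>(- real r gchoose j) * (x ^ (m + j) / Gamma (\<alpha> * real (m + j) + \<beta>))\<bar>)"
proof (rule summable_comparison_test')
  have "summable (\<lambda>j. (2 * \<bar>x\<bar>) ^ (j + m) / Gamma (\<alpha> * real (j + m) + \<beta>))"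
    using summable_power_over_Gamma[OF assms, of "2 * \<bar>x\<bar>"]
    by (subst summable_iff_shift[of "\<lambda>j. (2 * \<bar>x\<bar>) ^ j / Gamma (\<alpha> * real j + \<beta>)"])
  then show "summable (\<lambda>j. 2 ^ r * ((2 * \<bar>x\<bar>) ^ (m + j) / Gamma (\<alpha> * real (m + j) + \<beta>)))"
    by (intro summable_mult) (simp only: add.commute)
  fix j :: nat
  have pos: "0 < Gamma (\<alpha> * real (m + j) + \<beta>)"
    using assms by (intro Gamma_real_pos add_nonneg_pos) auto
  have "\<bar>- real r gchoose j\<bar> * \<bar>x\<bar> ^ (m + j) \<le> 2 ^ (r + j) * \<bar>x\<bar> ^ (m + j)"
    by (intro mult_right_mono abs_neg_gbinomial_le) simp
  also have "\<dots> \<le> 2 ^ (r + (m + j)) * \<bar>x\<bar> ^ (m + j)"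
    by (intro mult_right_mono power_increasing) simp_all
  also have "\<dots> = 2 ^ r * (2 * \<bar>x\<bar>) ^ (m + j)"
    by (simp only: power_add[of _ r] power_mult_distrib mult.assoc)
  finally have "\<bar>- real r gchoose j\<bar> * \<bar>x\<bar> ^ (m + j) / Gamma (\<alpha> * real (m + j) + \<beta>)
      \<le> 2 ^ r * (2 * \<bar>x\<bar>) ^ (m + j) / Gamma (\<alpha> * real (m + j) + \<beta>)"
    using pos by (intro divide_right_mono) auto
  then show "norm \<bar>(- real r gchoose j) * (x ^ (m + j) / Gamma (\<alpha> * real (m + j) + \<beta>))\<bar>
      \<le> 2 ^ r * ((2 * \<bar>x\<bar>) ^ (m + j) / Gamma (\<alpha> * real (m + j) + \<beta>))"
    using pos by (simp only: abs_mult abs_divide power_abs abs_of_pos[OF pos] real_norm_def abs_abs times_divide_eq_right)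
qed

lemma ml_erlang_sums:
  assumes "0 < \<alpha>"
  shows "(\<lambda>j. (- real r gchoose j) * (x ^ (r + j) / Gamma (\<alpha> * real (r + j) + 1))) sums ml_erlang \<alpha> r x"
  unfolding ml_erlang_def
  by (rule summable_sums[OF summable_rabs_cancel[OF summable_neg_gbinomial_over_Gamma[OF assms zero_less_one]]])

text \<open>
  Pascal's rule: the difference of the coefficients of \<open>x ^ (r + j)\<close> is \<open>- (r + 1) gchoose j\<close>, which is
  \<open>(-1) ^ j * (r + j)! / (r! * j!)\<close>.
\<close>

lemma ml_erlang_diff:
  assumes "0 < \<alpha>"
  shows "ml_erlang \<alpha> r x - ml_erlang \<alpha> (Suc r) x = x ^ r / fact r * altexp (\<lambda>k. ml_coeff \<alpha> (k + r)) x"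
proof -
  let ?g = "\<lambda>j. x ^ (r + j) / Gamma (\<alpha> * real (r + j) + 1)"
  \<comment> \<open>The coefficients of \<open>ml_erlang \<alpha> (Suc r)\<close>, moved up by one so that both series run over \<open>x ^ (r + j)\<close>.\<close>
  define b where "b j = (case j of 0 \<Rightarrow> 0 | Suc j \<Rightarrow> (- real (Suc r) gchoose j))" for j
  have "(\<lambda>j. b (Suc j) * ?g (Suc j)) sums ml_erlang \<alpha> (Suc r) x"
    using ml_erlang_sums[OF assms, of "Suc r" x] by (simp only: b_def nat.case add_Suc add_Suc_right)
  then have "(\<lambda>j. b j * ?g j) sums (ml_erlang \<alpha> (Suc r) x + b 0 * ?g 0)"
    by (rule sums_Suc)
  then have "(\<lambda>j. b j * ?g j) sums ml_erlang \<alpha> (Suc r) x"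
    by (simp add: b_def)
  from sums_diff[OF ml_erlang_sums[OF assms, of r x] this]
  have "(\<lambda>j. (- real r gchoose j) * ?g j - b j * ?g j) sums (ml_erlang \<alpha> r x - ml_erlang \<alpha> (Suc r) x)" .
  moreover have "(- real r gchoose j) * ?g j - b j * ?g j =
      x ^ r / fact r * (ml_coeff \<alpha> (j + r) * (-x) ^ j / fact j)" for j
  proof -
    have "(- real r gchoose j) - b j = (- real (Suc r) gchoose j)"
    proof (cases j)
      case (Suc i)
      have "- real r = - real (Suc r) + 1" by simp
      then have "(- real r gchoose Suc i) = (- real (Suc r) gchoose i) + (- real (Suc r) gchoose (Suc i))"
        by (simp only: gbinomial_Suc_Suc)
      then show ?thesis unfolding Suc b_def nat.case by (simp only: add_diff_cancel_left')
    qed (simp add: b_def)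
    also have "\<dots> = (-1) ^ j * (fact (r + j) / (fact j * fact r))"
      unfolding neg_gbinomial_Suc by (simp add: binomial_fact)
    finally have "(- real r gchoose j) * ?g j - b j * ?g j = (-1) ^ j * (fact (r + j) / (fact j * fact r)) * ?g j"
      by (simp only: left_diff_distrib[symmetric])
    also have "\<dots> = x ^ r / fact r * (ml_coeff \<alpha> (j + r) * (-x) ^ j / fact j)"
      unfolding ml_coeff_def power_minus[of x j] power_add add.commute[of j r] by (simp add: mult_ac)
    finally show ?thesis .
  qed
  ultimately have "(\<lambda>j. x ^ r / fact r * (ml_coeff \<alpha> (j + r) * (-x) ^ j / fact j)) sums
      (ml_erlang \<alpha> r x - ml_erlang \<alpha> (Suc r) x)" by (simp only:)
  moreover have "(\<lambda>j. x ^ r / fact r * (ml_coeff \<alpha> (j + r) * (-x) ^ j / fact j)) sums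
      (x ^ r / fact r * altexp (\<lambda>k. ml_coeff \<alpha> (k + r)) x)"
    unfolding altexp_def
    by (intro sums_mult summable_sums entire_egfD entire_egf_shift entire_ml_coeff assms)
  ultimately show ?thesis by (rule sums_unique2)
qed

lemma ml_erlang_0 [simp]: "ml_erlang \<alpha> 0 x = 1"
  unfolding ml_erlang_def
  by (subst suminf_finite[of "{0}"]) (auto simp: gbinomial_0_left)

text \<open>
  Substitute \<open>s = t * u\<close> in Euler's Beta integral. The open interval loses nothing, since \<open>0 powr c = 0\<close>
  makes the integrand vanish at both ends.
\<close>

lemma Beta_convolution:
  fixes a b t :: real
  assumes "0 < a" "0 < b" "0 < t"
  shows "has_bochner_integral lborel (\<lambda>s. indicator {0<..<t} s * ((t - s) powr (a - 1) * s powr (b - 1)))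
           (t powr (a + b - 1) * Beta a b)"
proof -
  let ?h = "\<lambda>u. u powr (b - 1) * (1 - u) powr (a - 1)"
  let ?f = "\<lambda>s. (indicator {0<..<t} s :: real) * ((t - s) powr (a - 1) * s powr (b - 1))"
  have "set_lebesgue_integral lborel {0..1} ?h = Beta b a"
    using set_borel_integral_eq_integral(2)[OF integrable_Beta[OF assms(2,1)]]
      has_integral_Beta_real[OF assms(2,1)] by (simp add: integral_unique)
  then have "has_bochner_integral lborel (\<lambda>u. indicator {0..1} u *\<^sub>R ?h u) (Beta b a)"
    using integrable_Beta[OF assms(2,1)]
    by (simp add: has_bochner_integral_iff set_integrable_def set_lebesgue_integral_def)
  then have "has_bochner_integral lborel (\<lambda>u. t powr (a + b - 2) * (indicator {0..1} u *\<^sub>R ?h u)) (t powr (a + b - 2) * Beta b a)"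
    by (intro has_bochner_integral_mult_right)
  moreover have "t powr (a + b - 2) * (indicator {0..1} u *\<^sub>R ?h u) = ?f (0 + t * u)" for u
  proof (cases "0 < u \<and> u < 1")
    case True
    have "(t - t * u) powr (a - 1) * (t * u) powr (b - 1) = (t powr (a - 1) * t powr (b - 1)) * ?h u"
      using True \<open>0 < t\<close> powr_mult[of t "1 - u" "a - 1"] powr_mult[of t u "b - 1"]
      by (simp add: right_diff_distrib)
    also have "t powr (a - 1) * t powr (b - 1) = t powr (a + b - 2)"
      by (simp flip: powr_add)
    finally show ?thesis
      using True \<open>0 < t\<close> by (simp add: indicator_def)
  next
    case False
    then have "u \<le> 0 \<or> 1 \<le> u" by auto
    moreover have "0 + t * u \<notin> {0<..<t}"
      using False \<open>0 < t\<close> by (auto simp: zero_less_mult_iff)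
    ultimately show ?thesis
      by (auto simp: indicator_def)
  qed
  moreover have "t powr (a + b - 2) = t powr (a + b - 1) / t"
    using powr_diff[of t "a + b - 1" 1] \<open>0 < t\<close> by simp
  ultimately have "has_bochner_integral lborel (\<lambda>u. ?f (0 + t * u)) ((t powr (a + b - 1) * Beta a b) /\<^sub>R \<bar>t\<bar>)"
    using \<open>0 < t\<close> by (simp add: Beta_commute field_simps)
  then show ?thesis
    using lborel_has_bochner_integral_real_affine_iff[of t ?f "t powr (a + b - 1) * Beta a b" 0] \<open>0 < t\<close>
    by simp
qed

text \<open>
  The interarrival density is the termwise derivative of \<open>ml_erlang \<alpha> 2 (lam * s powr \<alpha>)\<close>.
\<close>

lemma interarrival_density_sums:
  assumes "0 < \<alpha>" "0 < s"
  shows "(\<lambda>j. (- 2 gchoose j) * (lam ^ (2 + j) * s powr (\<alpha> * real (2 + j) - 1) / Gamma (\<alpha> * real (2 + j))))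
           sums interarrival_density lam \<alpha> s"
    and "summable (\<lambda>j. \<bar>(- 2 gchoose j) * (lam ^ (2 + j) * s powr (\<alpha> * real (2 + j) - 1) / Gamma (\<alpha> * real (2 + j)))\<bar>)"
proof -
  define y where "y = lam * s powr \<alpha>"
  let ?b = "\<lambda>j. (- 2 gchoose j) * (lam ^ (2 + j) * s powr (\<alpha> * real (2 + j) - 1) / Gamma (\<alpha> * real (2 + j)))"
  let ?c = "\<lambda>j. (- real 2 gchoose j) * (y ^ (0 + j) / Gamma (\<alpha> * real (0 + j) + 2 * \<alpha>))"
  define K where "K = lam\<^sup>2 * s powr (2 * \<alpha> - 1)"
  have b: "?b j = K * ?c j" for j
  proof -
    have "s powr (\<alpha> * real (2 + j) - 1) = s powr (2 * \<alpha> - 1) * (s powr \<alpha>) ^ j"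
      using \<open>0 < s\<close> by (simp add: powr_powr algebra_simps flip: powr_add powr_realpow)
    moreover have "\<alpha> * real (2 + j) = \<alpha> * real (0 + j) + 2 * \<alpha>" by (simp add: algebra_simps)
    ultimately show ?thesis
      by (simp add: K_def y_def power_add power_mult_distrib power2_eq_square)
  qed
  have sum: "summable (\<lambda>j. \<bar>?c j\<bar>)"
    by (rule summable_neg_gbinomial_over_Gamma) (use assms in auto)
  have K_sums: "(\<lambda>j. K * ?c j) sums (K * (\<Sum>j. ?c j))"
    by (intro sums_mult summable_sums summable_rabs_cancel[OF sum])
  have c: "?c j = Gamma (real j + 2) * (- lam * s powr \<alpha>) ^ j / (fact j * Gamma (real j * \<alpha> + 2 * \<alpha>))" for j
  proof -
    have "Gamma (real j + 2) = fact (Suc j)"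
      using Gamma_fact[of "Suc j", where ?'a = real] by (simp add: add_ac)
    then have "Gamma (real j + 2) / fact j = real (Suc j)"
      by simp
    moreover have "(- real 2 gchoose j) = (-1) ^ j * real (Suc j)"
      using neg_gbinomial_Suc[of 1 j] by (simp add: numeral_2_eq_2 binomial_symmetric[of j "Suc j"])
    ultimately have "(- real 2 gchoose j) = (-1) ^ j * (Gamma (real j + 2) / fact j)" by simp
    then have "?c j = Gamma (real j + 2) * ((-1) ^ j * y ^ j) / (fact j * Gamma (real j * \<alpha> + 2 * \<alpha>))"
      by (simp add: mult.commute[of \<alpha>])
    moreover have "(- lam * s powr \<alpha>) ^ j = (-1) ^ j * y ^ j"
      by (simp add: y_def power_minus[of "lam * s powr \<alpha>"])
    ultimately show ?thesis by (simp only:)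
  qed
  have "Gamma (2::real) = 1"
    using Gamma_fact[of 1, where ?'a = real] by simp
  then have "(\<Sum>j. ?c j) = mittag_leffler3 \<alpha> (2 * \<alpha>) 2 (- lam * s powr \<alpha>)"
    by (simp only: mittag_leffler3_def c div_by_1 mult_1_left)
  with \<open>0 < s\<close> have "K * (\<Sum>j. ?c j) = interarrival_density lam \<alpha> s"
    by (simp only: interarrival_density_def K_def if_True)
  with K_sums have "(\<lambda>j. K * ?c j) sums interarrival_density lam \<alpha> s"
    by (simp only:)
  then show "?b sums interarrival_density lam \<alpha> s" unfolding b .
  show "summable (\<lambda>j. \<bar>?b j\<bar>)"
    unfolding b abs_mult[of K] by (rule summable_mult[OF sum])
qed

text \<open>
  The product of two terms in the series of \<open>ml_erlang\<close> and of the density. The Gamma values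
  in the Beta integral cancel the two denominators, leaving a term of the same shape. The integral of the
  absolute value is recorded too, because it controls the interchange of sum and integral.
\<close>

lemma ml_erlang_kernel_product:
  fixes \<alpha> lam t :: real and i j r :: nat
  assumes "0 < \<alpha>" "0 \<le> lam" "0 < t"
  defines "D \<equiv> (- real r gchoose i) * (- 2 gchoose j)"
  defines "v \<equiv> (lam * t powr \<alpha>) ^ (r + 2 + (i + j)) / Gamma (\<alpha> * real (r + 2 + (i + j)) + 1)"
  defines "h \<equiv> (\<lambda>s. indicat_real {0<..<t} s *
            (((- real r gchoose i) * ((lam * (t - s) powr \<alpha>) ^ (r + i) / Gamma (\<alpha> * real (r + i) + 1))) *
             ((- 2 gchoose j) * (lam ^ (2 + j) * s powr (\<alpha> * real (2 + j) - 1) / Gamma (\<alpha> * real (2 + j))))))"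
  shows "has_bochner_integral lborel h (D * v)"
    and "has_bochner_integral lborel (\<lambda>s. \<bar>h s\<bar>) (\<bar>D\<bar> * v)"
proof -
  define a where "a = \<alpha> * real (r + i) + 1"
  define b where "b = \<alpha> * real (2 + j)"
  have ab: "0 < a" "0 < b"
    using assms(1) by (auto simp: a_def b_def intro!: add_nonneg_pos)
  have G: "0 < Gamma a" "0 < Gamma b" "0 < Gamma (a + b)" using ab by auto
  define L where "L = lam ^ (r + 2 + (i + j)) / (Gamma a * Gamma b)"
  define k where "k s = indicat_real {0<..<t} s * ((t - s) powr (a - 1) * s powr (b - 1))" for s
  have "has_bochner_integral lborel k (t powr (a + b - 1) * Beta a b)"
    unfolding k_def[abs_def] by (rule Beta_convolution[OF ab \<open>0 < t\<close>])
  then have "has_bochner_integral lborel (\<lambda>s. L * k s) (L * (t powr (a + b - 1) * Beta a b))"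
    by (rule has_bochner_integral_mult_right)
  moreover have "L * (t powr (a + b - 1) * Beta a b) = v"
  proof -
    have e: "a + b - 1 = \<alpha> * real (r + 2 + (i + j))" "a + b = \<alpha> * real (r + 2 + (i + j)) + 1"
      by (simp_all add: a_def b_def algebra_simps)
    have "t powr (a + b - 1) = (t powr \<alpha>) ^ (r + 2 + (i + j))"
      unfolding e(1) using \<open>0 < t\<close> by (simp only: powr_powr[symmetric] powr_realpow powr_gt_zero)
    moreover have "Beta a b = Gamma a * Gamma b / Gamma (a + b)"
      by (simp only: Beta_def)
    ultimately show ?thesis
      unfolding v_def L_def e(2)[symmetric] power_mult_distrib[of lam] using G by simp
  qed
  ultimately have Lk: "has_bochner_integral lborel (\<lambda>s. L * k s) v" by (simp only:)
  have h: "h = (\<lambda>s. D * (L * k s))"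
  proof
    fix s show "h s = D * (L * k s)"
    proof (cases "s \<in> {0<..<t}")
      case True
      then have pw: "(t - s) powr (a - 1) = ((t - s) powr \<alpha>) ^ (r + i)"
        by (simp add: a_def powr_powr[symmetric] powr_realpow del: of_nat_add)
      have lam_pw: "lam ^ (r + 2 + (i + j)) = lam ^ (r + i) * lam ^ (2 + j)"
        by (simp add: power_add mult_ac)
      show ?thesis
        unfolding h_def k_def D_def L_def a_def[symmetric] b_def[symmetric] power_mult_distrib[of lam] pw lam_pw
        by (simp add: field_simps)
    next
      case False
      then show ?thesis by (simp add: h_def k_def)
    qed
  qed
  have "0 \<le> L * k s" for s
    using assms(2) G by (auto simp: L_def k_def intro!: mult_nonneg_nonneg divide_nonneg_nonneg)
  then have "\<bar>h s\<bar> = \<bar>D\<bar> * (L * k s)" for s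
    unfolding h abs_mult[of D] by (simp only: abs_of_nonneg)
  moreover show "has_bochner_integral lborel h (D * v)"
    unfolding h by (rule has_bochner_integral_mult_right[OF Lk])
  ultimately show "has_bochner_integral lborel (\<lambda>s. \<bar>h s\<bar>) (\<bar>D\<bar> * v)"
    using has_bochner_integral_mult_right[OF Lk, of "\<bar>D\<bar>"] by (simp only:)
qed

text \<open>
  Adding an interarrival time raises the index by two. The integrand is expanded as a Cauchy product, whose
  diagonal sums are integrated term by term and collected by Vandermonde's identity.
\<close>

lemma ml_erlang_convolution:
  fixes \<alpha> lam t :: real and r :: nat
  assumes "0 < \<alpha>" "0 \<le> lam" "0 < t"
  shows "(LINT s|lborel. indicat_real {0<..<t} s * (ml_erlang \<alpha> r (lam * (t - s) powr \<alpha>) * interarrival_density lam \<alpha> s))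
     = ml_erlang \<alpha> (r + 2) (lam * t powr \<alpha>)"
proof -
  define A where "A i s = (- real r gchoose i) * ((lam * (t - s) powr \<alpha>) ^ (r + i) / Gamma (\<alpha> * real (r + i) + 1))" for i s
  define B where "B j s = (- 2 gchoose j) * (lam ^ (2 + j) * s powr (\<alpha> * real (2 + j) - 1) / Gamma (\<alpha> * real (2 + j)))" for j s
  define v where "v m = (lam * t powr \<alpha>) ^ (r + 2 + m) / Gamma (\<alpha> * real (r + 2 + m) + 1)" for m
  define f where "f m s = indicat_real {0<..<t} s * (\<Sum>i\<le>m. A i s * B (m - i) s)" for m s
  have f_alt: "f m = (\<lambda>s. \<Sum>i\<le>m. indicat_real {0<..<t} s * (A i s * B (m - i) s))" for m
    by (simp only: f_def[abs_def] sum_distrib_left)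
  have two: "- real r + - 2 = - real (r + 2)" by simp
  have vandermonde: "(\<Sum>i\<le>m. (- real r gchoose i) * (- 2 gchoose (m - i))) = (- real (r + 2) gchoose m)" for m
    using gbinomial_Vandermonde[of "- real r" "- 2" m] unfolding two atMost_atLeast0 .
  have product: "has_bochner_integral lborel (\<lambda>s. indicat_real {0<..<t} s * (A i s * B (m - i) s)) ((- real r gchoose i) * (- 2 gchoose (m - i)) * v m)"
      "has_bochner_integral lborel (\<lambda>s. \<bar>indicat_real {0<..<t} s * (A i s * B (m - i) s)\<bar>) (\<bar>(- real r gchoose i) * (- 2 gchoose (m - i))\<bar> * v m)"
    if "i \<le> m" for i m
    using ml_erlang_kernel_product[OF assms, of r i "m - i"] that
    unfolding A_def B_def v_def by (simp_all only: le_add_diff_inverse)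
  have f_int: "has_bochner_integral lborel (f m) ((- real (r + 2) gchoose m) * v m)" for m
    unfolding f_alt vandermonde[symmetric] sum_distrib_right
    by (rule has_bochner_integral_sum) (rule product(1), simp)
  have v_nonneg: "0 \<le> v m" for m
    unfolding v_def using assms by (intro divide_nonneg_nonneg zero_le_power mult_nonneg_nonneg less_imp_le[OF Gamma_real_pos] add_nonneg_pos) auto
  have f_norm: "(LINT s|lborel. norm (f m s)) \<le> \<bar>- real (r + 2) gchoose m\<bar> * v m" for m
  proof -
    have "has_bochner_integral lborel (\<lambda>s. \<Sum>i\<le>m. \<bar>indicat_real {0<..<t} s * (A i s * B (m - i) s)\<bar>)
        (\<Sum>i\<le>m. \<bar>(- real r gchoose i) * (- 2 gchoose (m - i))\<bar> * v m)" (is "has_bochner_integral _ ?g ?w")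
      by (rule has_bochner_integral_sum) (rule product(2), simp)
    then have g: "integrable lborel ?g" "integral\<^sup>L lborel ?g = ?w"
      by (simp_all only: has_bochner_integral_iff)
    have "(LINT s|lborel. norm (f m s)) \<le> integral\<^sup>L lborel ?g"
    proof (rule integral_mono)
      show "integrable lborel (\<lambda>s. norm (f m s))"
        using f_int[of m] by (simp add: has_bochner_integral_iff)
      show "norm (f m s) \<le> ?g s" for s
        unfolding f_alt real_norm_def by (rule sum_abs)
    qed (rule g(1))
    also have "\<dots> = (\<Sum>i\<le>m. (-1) ^ m * ((- real r gchoose i) * (- 2 gchoose (m - i)))) * v m"
      unfolding g(2) sum_distrib_right
    proof (intro sum.cong refl)
      fix i assume "i \<in> {..m}"
      then have "(-1::real) ^ m = (-1) ^ i * (-1) ^ (m - i)"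
        by (simp flip: power_add)
      then have "\<bar>(- real r gchoose i) * (- 2 gchoose (m - i))\<bar> = (-1) ^ m * ((- real r gchoose i) * (- 2 gchoose (m - i)))"
        using abs_neg_gbinomial[of r i] abs_neg_gbinomial[of 2 "m - i"] by (simp add: abs_mult)
      then show "\<bar>(- real r gchoose i) * (- 2 gchoose (m - i))\<bar> * v m = (-1) ^ m * ((- real r gchoose i) * (- 2 gchoose (m - i))) * v m"
        by (simp only:)
    qed
    also have "\<dots> = \<bar>- real (r + 2) gchoose m\<bar> * v m"
      unfolding sum_distrib_left[symmetric] vandermonde abs_neg_gbinomial ..
    finally show ?thesis .
  qed
  have AB: "summable (\<lambda>i. norm (A i s))" "(\<lambda>i. A i s) sums ml_erlang \<alpha> r (lam * (t - s) powr \<alpha>)"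
      "summable (\<lambda>j. norm (B j s))" "(\<lambda>j. B j s) sums interarrival_density lam \<alpha> s"
    if "s \<in> {0<..<t}" for s
    using summable_neg_gbinomial_over_Gamma[OF assms(1) zero_less_one, of r _ r] ml_erlang_sums[OF assms(1), of r]
      interarrival_density_sums[OF assms(1), of s lam] that
    unfolding A_def B_def real_norm_def by (simp_all only: greaterThanLessThan_iff)
  have f_sum: "(\<Sum>m. f m s) = indicat_real {0<..<t} s * (ml_erlang \<alpha> r (lam * (t - s) powr \<alpha>) * interarrival_density lam \<alpha> s)" for s
  proof (cases "s \<in> {0<..<t}")
    case True
    from Cauchy_product_sums[OF AB(1,3)[OF True]] AB(2,4)[OF True]
    show ?thesis using True by (simp add: f_def sums_iff)
  qed (simp add: f_def)
  have "(\<lambda>m. integral\<^sup>L lborel (f m)) sums (LINT s|lborel. (\<Sum>m. f m s))"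
  proof (rule sums_integral)
    show "integrable lborel (f m)" for m
      using f_int[of m] by (simp only: has_bochner_integral_iff)
    show "AE s in lborel. summable (\<lambda>m. norm (f m s))"
    proof (rule AE_I2)
      fix s :: real
      show "summable (\<lambda>m. norm (f m s))"
      proof (cases "s \<in> {0<..<t}")
        case True
        have "summable (\<lambda>m. \<Sum>i\<le>m. norm (A i s) * norm (B (m - i) s))"
          using AB(1,3)[OF True] by (intro summable_Cauchy_product) simp_all
        then show ?thesis
        proof (rule summable_comparison_test')
          show "norm (norm (f m s)) \<le> (\<Sum>i\<le>m. norm (A i s) * norm (B (m - i) s))" for m
            using True sum_norm_le[of "{..m}" "\<lambda>i. A i s * B (m - i) s" "\<lambda>i. norm (A i s) * norm (B (m - i) s)"]
            by (simp add: f_def abs_mult)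
        qed
      qed (simp add: f_def)
    qed
    show "summable (\<lambda>m. LINT s|lborel. norm (f m s))"
    proof (rule summable_comparison_test')
      show "summable (\<lambda>m. \<bar>(- real (r + 2) gchoose m) * v m\<bar>)"
        unfolding v_def by (rule summable_neg_gbinomial_over_Gamma[OF assms(1) zero_less_one])
      show "norm (LINT s|lborel. norm (f m s)) \<le> \<bar>(- real (r + 2) gchoose m) * v m\<bar>" for m
        using f_norm[of m] v_nonneg[of m] by (simp add: abs_mult)
    qed
  qed
  moreover have "integral\<^sup>L lborel (f m) = (- real (r + 2) gchoose m) * v m" for m
    using f_int[of m] by (simp only: has_bochner_integral_iff)
  ultimately have "(\<lambda>m. (- real (r + 2) gchoose m) * v m) sums (LINT s|lborel. (\<Sum>m. f m s))"
    by (simp only:)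
  moreover have "(\<lambda>m. (- real (r + 2) gchoose m) * v m) sums ml_erlang \<alpha> (r + 2) (lam * t powr \<alpha>)"
    unfolding v_def by (rule ml_erlang_sums[OF assms(1)])
  ultimately show ?thesis
    unfolding f_sum by (rule sums_unique2)
qed

lemma ml_erlang_measurable [measurable]: "ml_erlang \<alpha> r \<in> borel_measurable borel"
  unfolding ml_erlang_def[abs_def] by measurable

lemma interarrival_density_measurable [measurable]:
  "interarrival_density lam \<alpha> \<in> borel_measurable borel"
  unfolding interarrival_density_def[abs_def] mittag_leffler3_def by measurable

text \<open>
  Since \<open>\<bar>- r gchoose j\<bar> \<le> 2 ^ (r + j)\<close>, the value is bounded by a tail, from index \<open>r\<close> on, of one
  convergent series. This is what excludes infinitely many renewals in bounded time.
\<close>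

lemma ml_erlang_tendsto_0:
  assumes "0 < \<alpha>"
  shows "(\<lambda>r. ml_erlang \<alpha> r x) \<longlonglongrightarrow> 0"
proof -
  define a where "a k = (2 * \<bar>x\<bar>) ^ k / Gamma (\<alpha> * real k + 1)" for k
  have a: "summable a"
    unfolding a_def by (rule summable_power_over_Gamma[OF assms zero_less_one])
  have le: "\<bar>ml_erlang \<alpha> r x\<bar> \<le> suminf a - sum a {..<r}" for r
  proof -
    let ?g = "\<lambda>j. (- real r gchoose j) * (x ^ (r + j) / Gamma (\<alpha> * real (r + j) + 1))"
    have g: "summable (\<lambda>j. \<bar>?g j\<bar>)"
      by (rule summable_neg_gbinomial_over_Gamma[OF assms zero_less_one])
    have shift: "summable (\<lambda>j. a (j + r))"
      using a by (rule summable_ignore_initial_segment)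
    have "\<bar>?g j\<bar> \<le> a (j + r)" for j
    proof -
      have pos: "0 < Gamma (\<alpha> * real (r + j) + 1)"
        using assms by (intro Gamma_real_pos add_nonneg_pos) auto
      have "\<bar>?g j\<bar> = \<bar>- real r gchoose j\<bar> * (\<bar>x\<bar> ^ (r + j) / Gamma (\<alpha> * real (r + j) + 1))"
        by (simp only: abs_mult abs_divide power_abs abs_of_pos[OF pos])
      also have "\<dots> \<le> 2 ^ (r + j) * (\<bar>x\<bar> ^ (r + j) / Gamma (\<alpha> * real (r + j) + 1))"
        using pos by (intro mult_right_mono abs_neg_gbinomial_le divide_nonneg_nonneg) auto
      also have "\<dots> = a (j + r)"
        by (simp only: a_def power_mult_distrib add.commute[of j r] times_divide_eq_right)
      finally show ?thesis .
    qed
    then have "(\<Sum>j. \<bar>?g j\<bar>) \<le> (\<Sum>j. a (j + r))"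
      by (rule suminf_le[OF _ g shift])
    then show ?thesis
      using summable_rabs[OF g] suminf_minus_initial_segment[OF a, of r]
      unfolding ml_erlang_def by linarith
  qed
  have "(\<lambda>r. suminf a - sum a {..<r}) \<longlonglongrightarrow> suminf a - suminf a"
    by (intro tendsto_diff tendsto_const summable_LIMSEQ a)
  then have "(\<lambda>r. suminf a - sum a {..<r}) \<longlonglongrightarrow> 0" by simp
  then show ?thesis
    by (rule Lim_null_comparison[rotated]) (simp add: le)
qed

section \<open>Independence and real random variables\<close>

lemma (in prob_space) indep_var_commute:
  assumes "indep_var N X N' Y"
  shows "indep_var N' Y N X"
proof -
  let ?\<sigma> = "\<lambda>N X. sigma_sets (space M) {X -` A \<inter> space M | A. A \<in> sets N}"
  have "indep_set (?\<sigma> N X) (?\<sigma> N' Y)"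
    using assms by (simp only: indep_var_eq)
  then have "indep_set (?\<sigma> N' Y) (?\<sigma> N X)"
    unfolding indep_sets2_eq
  proof (elim conjE, intro conjI ballI)
    fix a b
    assume "\<forall>a\<in>?\<sigma> N X. \<forall>b\<in>?\<sigma> N' Y. prob (a \<inter> b) = prob a * prob b" "a \<in> ?\<sigma> N' Y" "b \<in> ?\<sigma> N X"
    then have "prob (b \<inter> a) = prob b * prob a" by blast
    then show "prob (a \<inter> b) = prob a * prob b"
      by (simp only: Int_commute[of a b] mult.commute[of "prob a"])
  qed
  then show ?thesis
    using assms by (simp only: indep_var_eq)
qed

lemma (in prob_space) prob_le_indep_var:
  fixes X Y :: "'a \<Rightarrow> real"
  assumes indep: "indep_var borel X borel Y"
  shows "prob {\<omega> \<in> space M. X \<omega> \<le> Y \<omega>} = expectation (\<lambda>\<omega>. prob {\<omega>' \<in> space M. X \<omega>' \<le> Y \<omega>})"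
proof -
  have [measurable]: "X \<in> borel_measurable M" "Y \<in> borel_measurable M"
    using indep by (auto dest: indep_var_rv1 indep_var_rv2)
  let ?X = "distr M borel X" and ?Y = "distr M borel Y"
  let ?f = "\<lambda>x y. indicat_real {z. fst z \<le> snd z} (x, y :: real)"
  interpret X: prob_space ?X by (rule prob_space_distr) simp
  interpret Y: prob_space ?Y by (rule prob_space_distr) simp
  interpret P: pair_prob_space ?X ?Y ..
  have joint: "?X \<Otimes>\<^sub>M ?Y = distr M (borel \<Otimes>\<^sub>M borel) (\<lambda>\<omega>. (X \<omega>, Y \<omega>))"
    using indep by (simp add: indep_var_distribution_eq)
  have f_meas: "case_prod ?f \<in> borel_measurable (borel \<Otimes>\<^sub>M borel)"
    unfolding case_prod_beta prod.collapse by measurable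
  have "prob {\<omega> \<in> space M. X \<omega> \<le> Y \<omega>} = (LINT \<omega>|M. indicat_real {\<omega> \<in> space M. X \<omega> \<le> Y \<omega>} \<omega>)"
    by simp
  also have "\<dots> = (LINT \<omega>|M. ?f (X \<omega>) (Y \<omega>))"
    by (intro Bochner_Integration.integral_cong) (auto simp: indicator_def)
  also have "\<dots> = integral\<^sup>L (?X \<Otimes>\<^sub>M ?Y) (case_prod ?f)"
    unfolding joint using f_meas by (subst integral_distr) auto
  also have "\<dots> = (LINT y|?Y. (LINT x|?X. ?f x y))"
  proof (rule P.integral_snd[symmetric])
    show "integrable (?X \<Otimes>\<^sub>M ?Y) (case_prod ?f)"
      using f_meas by (intro P.integrable_const_bound[of _ 1]) (auto simp: indicator_def)
  qed
  also have "(\<lambda>y. LINT x|?X. ?f x y) = (\<lambda>y. prob {\<omega>' \<in> space M. X \<omega>' \<le> y})"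
  proof
    fix y
    have "(LINT x|?X. ?f x y) = (LINT x|?X. indicat_real {..y} x)"
      by (intro Bochner_Integration.integral_cong) (auto simp: indicator_def)
    also have "\<dots> = prob (X -` {..y} \<inter> space M)"
      by (simp add: measure_distr)
    also have "X -` {..y} \<inter> space M = {\<omega>' \<in> space M. X \<omega>' \<le> y}" by auto
    finally show "(LINT x|?X. ?f x y) = prob {\<omega>' \<in> space M. X \<omega>' \<le> y}" .
  qed
  also have "(LINT y|?Y. prob {\<omega>' \<in> space M. X \<omega>' \<le> y}) = expectation (\<lambda>\<omega>. prob {\<omega>' \<in> space M. X \<omega>' \<le> Y \<omega>})"
  proof (rule integral_distr)
    have "mono (\<lambda>y. prob {\<omega>' \<in> space M. X \<omega>' \<le> y})"
      by (intro monoI finite_measure_mono) auto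
    then show "(\<lambda>y. prob {\<omega>' \<in> space M. X \<omega>' \<le> y}) \<in> borel_measurable borel"
      by (rule borel_measurable_mono)
  qed simp
  finally show ?thesis .
qed

text \<open>
  The half-lines \<open>{..b}\<close> form an intersection-stable generator of the Borel sets. This form is needed since
  independence of the renewal times will be read off from the counting process at fixed times.
\<close>

lemma (in prob_space) indep_var_atMostI:
  fixes X :: "'a \<Rightarrow> real" and Y :: "'a \<Rightarrow> real"
  assumes X[measurable]: "X \<in> borel_measurable M" and Y[measurable]: "Y \<in> borel_measurable M"
    and indep: "\<And>A b. A \<in> sets borel \<Longrightarrow>
      prob {\<omega> \<in> space M. X \<omega> \<in> A \<and> Y \<omega> \<le> b} = prob {\<omega> \<in> space M. X \<omega> \<in> A} * prob {\<omega> \<in> space M. Y \<omega> \<le> b}"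
  shows "indep_var borel X borel Y"
proof -
  let ?A = "{X -` A \<inter> space M | A. A \<in> sets borel}"
  let ?B = "{Y -` A \<inter> space M | A. A \<in> range atMost}"
  have "indep_set ?A ?B"
  proof (rule indep_setI)
    show "?A \<subseteq> events" "?B \<subseteq> events" by (auto intro: measurable_sets)
    fix a b assume "a \<in> ?A" "b \<in> ?B"
    then obtain A y where ab: "A \<in> sets borel" "a = X -` A \<inter> space M" "b = Y -` {..y} \<inter> space M" by auto
    have eqs: "a \<inter> b = {\<omega> \<in> space M. X \<omega> \<in> A \<and> Y \<omega> \<le> y}" "a = {\<omega> \<in> space M. X \<omega> \<in> A}"
      "b = {\<omega> \<in> space M. Y \<omega> \<le> y}" using ab by auto
    show "prob (a \<inter> b) = prob a * prob b"
      unfolding eqs(1) unfolding eqs(2,3) by (rule indep[OF ab(1)])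
  qed
  moreover have "Int_stable ?A"
  proof (rule Int_stableI)
    fix a b assume "a \<in> ?A" "b \<in> ?A"
    then obtain A B where "A \<in> sets borel" "B \<in> sets borel" "a \<inter> b = X -` (A \<inter> B) \<inter> space M" by auto
    then show "a \<inter> b \<in> ?A" by blast
  qed
  moreover have "Int_stable ?B"
  proof (rule Int_stableI)
    fix a b assume "a \<in> ?B" "b \<in> ?B"
    then obtain x y where "a = Y -` {..x} \<inter> space M" "b = Y -` {..y} \<inter> space M" by auto
    then have "a \<inter> b = Y -` {..min x y} \<inter> space M" by auto
    then show "a \<inter> b \<in> ?B" by blast
  qed
  ultimately have "indep_set (sigma_sets (space M) ?A) (sigma_sets (space M) ?B)"
    by (rule indep_set_sigma_sets)
  moreover have "sigma_sets (space M) ?B = {Y -` A \<inter> space M | A. A \<in> sigma_sets UNIV (range atMost)}"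
    by (rule sigma_sets_vimage_commute[symmetric]) simp
  moreover have "sigma_sets UNIV (range atMost) = sets (borel :: real measure)"
    by (simp add: borel_eq_atMost)
  moreover have "sigma_sets (space M) {Y -` A \<inter> space M | A. A \<in> sets borel} = {Y -` A \<inter> space M | A. A \<in> sets borel}"
    using sigma_sets_vimage_commute[of Y "space M" UNIV "sets borel"] sets.sigma_sets_eq[of "borel :: real measure"] by simp
  ultimately show ?thesis
    unfolding indep_var_eq using X Y by (simp only: simp_thms)
qed

section \<open>The renewal process\<close>

text \<open>
  The duality between counts and epochs. Unboundedness makes the counted set finite, so that \<open>card\<close> is
  its true size.
\<close>

lemma le_card_sublevel_iff:
  fixes S :: "nat \<Rightarrow> real"
  assumes "mono S" "S 0 \<le> b" and unbounded: "\<exists>m. b < S m"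
  shows "n \<le> card {m. 1 \<le> m \<and> S m \<le> b} \<longleftrightarrow> S n \<le> b"
proof
  obtain k where k: "b < S k" using unbounded by blast
  have lt: "m < k" if "S m \<le> b" "b < S k" for m k
  proof (rule ccontr)
    assume "\<not> m < k"
    then have "S k \<le> S m" using monoD[OF \<open>mono S\<close>, of k m] by simp
    with that show False by simp
  qed
  show "S n \<le> b" if "n \<le> card {m. 1 \<le> m \<and> S m \<le> b}"
  proof (rule ccontr)
    assume "\<not> S n \<le> b"
    then have "b < S n" by simp
    then have "1 \<le> n" using assms(2) by (cases "n = 0") auto
    have "{m. 1 \<le> m \<and> S m \<le> b} \<subseteq> {1..<n}"
      using lt[OF _ \<open>b < S n\<close>] by auto
    from card_mono[OF _ this] that \<open>1 \<le> n\<close> show False by simp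
  qed
  show "n \<le> card {m. 1 \<le> m \<and> S m \<le> b}" if "S n \<le> b"
  proof -
    have "finite {m. 1 \<le> m \<and> S m \<le> b}"
    proof (rule finite_subset)
      show "{m. 1 \<le> m \<and> S m \<le> b} \<subseteq> {..<k}" using lt[OF _ k] by auto
    qed simp
    moreover have "{1..n} \<subseteq> {m. 1 \<le> m \<and> S m \<le> b}"
    proof
      fix m assume m: "m \<in> {1..n}"
      then have "S m \<le> S n" using monoD[OF \<open>mono S\<close>, of m n] by simp
      with m that show "m \<in> {m. 1 \<le> m \<and> S m \<le> b}" by simp
    qed
    ultimately have "card {1..n} \<le> card {m. 1 \<le> m \<and> S m \<le> b}" by (rule card_mono)
    then show ?thesis by simp
  qed
qed

locale ml_renewal = prob_space M for M :: "'a measure" +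
  fixes T :: "nat \<Rightarrow> 'a \<Rightarrow> real" and lam \<alpha> :: real
  assumes lam_pos: "0 < lam" and alpha_pos: "0 < \<alpha>"
    and T_indep: "indep_vars (\<lambda>_. borel) T UNIV"
    and T_law: "\<And>i. has_density M (T i) (interarrival_density lam \<alpha>)"
begin

definition epoch :: "nat \<Rightarrow> 'a \<Rightarrow> real" where
  "epoch m \<omega> = (\<Sum>i<m. T i \<omega>)"

lemma T_measurable [measurable]: "T i \<in> borel_measurable M"
  using T_indep unfolding indep_vars_def2 by simp

lemma epoch_measurable [measurable]: "epoch m \<in> borel_measurable M"
  unfolding epoch_def[abs_def] by measurable

lemma expectation_T:
  assumes [measurable]: "g \<in> borel_measurable borel"
  shows "expectation (\<lambda>\<omega>. g (T i \<omega>)) = (LINT s|lborel. max 0 (interarrival_density lam \<alpha> s) * g s)"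
proof -
  have "ennreal (max 0 y) = ennreal y" for y
    by (simp add: max_def ennreal_neg)
  then have "distributed M lborel (T i) (\<lambda>s. ennreal (max 0 (interarrival_density lam \<alpha> s)))"
    using T_law[of i] by (simp only: has_density_def)
  then show ?thesis
    by (subst distributed_integral[symmetric]) auto
qed

lemma interarrival_density_nonneg: "AE s in lborel. 0 \<le> interarrival_density lam \<alpha> s"
  using T_law[of 0] by (simp only: has_density_def)

lemma T_pos: "AE \<omega> in M. 0 < T i \<omega>"
proof -
  have "prob {\<omega> \<in> space M. T i \<omega> \<le> 0} = expectation (\<lambda>\<omega>. indicat_real {\<omega> \<in> space M. T i \<omega> \<le> 0} \<omega>)"
    by simp
  also have "\<dots> = expectation (\<lambda>\<omega>. indicat_real {..0} (T i \<omega>))"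
    by (intro Bochner_Integration.integral_cong) (auto simp: indicator_def)
  also have "\<dots> = (LINT s|lborel. max 0 (interarrival_density lam \<alpha> s) * indicat_real {..0} s)"
    by (rule expectation_T) simp
  also have "(\<lambda>s. max 0 (interarrival_density lam \<alpha> s) * indicat_real {..0} s) = (\<lambda>s. 0)"
    by (auto simp: interarrival_density_def indicator_def)
  finally have "prob {\<omega> \<in> space M. T i \<omega> \<le> 0} = 0" by simp
  then have "AE \<omega> in M. \<not> T i \<omega> \<le> 0"
    using prob_Collect_eq_0[where P = "\<lambda>\<omega>. T i \<omega> \<le> 0"] by simp
  then show ?thesis
    by eventually_elim simp
qed

lemma epoch_mono: "AE \<omega> in M. mono (\<lambda>m. epoch m \<omega>)"
proof -
  have "AE \<omega> in M. \<forall>i. 0 < T i \<omega>"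
    using T_pos by (simp add: AE_all_countable)
  then show ?thesis
  proof eventually_elim
    case (elim \<omega>)
    show ?case
      unfolding mono_iff_le_Suc epoch_def using elim by (simp add: less_imp_le)
  qed
qed

lemma epoch_0 [simp]: "epoch 0 \<omega> = 0"
  by (simp add: epoch_def)

lemma epoch_nonneg: "AE \<omega> in M. 0 \<le> epoch m \<omega>"
  using epoch_mono by eventually_elim (metis epoch_0 monoD le0)

lemma prob_epoch_neg:
  assumes "b < 0"
  shows "prob {\<omega> \<in> space M. epoch m \<omega> \<le> b} = 0"
proof -
  have "AE \<omega> in M. \<not> epoch m \<omega> \<le> b"
    using epoch_nonneg[of m] by eventually_elim (use assms in linarith)
  then show ?thesis
    by (intro iffD2[OF prob_Collect_eq_0]) measurable
qed

text \<open>
  Induction on the number of renewals: condition on the last interarrival time. At \<open>t = 0\<close> the convolution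
  interval is empty and the claim amounts to positivity of the interarrival times.
\<close>

lemma prob_epoch_le:
  assumes "0 \<le> t"
  shows "prob {\<omega> \<in> space M. epoch n \<omega> \<le> t} = ml_erlang \<alpha> (2 * n) (lam * t powr \<alpha>)"
  using assms
proof (induction n arbitrary: t)
  case 0
  then show ?case by (simp add: prob_space)
next
  case (Suc n)
  show ?case
  proof (cases "t = 0")
    case True
    have "AE \<omega> in M. \<not> epoch (Suc n) \<omega> \<le> t"
      using epoch_nonneg[of n] T_pos[of n]
    proof eventually_elim
      case (elim \<omega>)
      have "epoch (Suc n) \<omega> = epoch n \<omega> + T n \<omega>" by (simp add: epoch_def)
      with elim True show ?case by linarith
    qed
    then have "prob {\<omega> \<in> space M. epoch (Suc n) \<omega> \<le> t} = 0"
      by (intro iffD2[OF prob_Collect_eq_0]) measurable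
    moreover have "ml_erlang \<alpha> (2 * Suc n) 0 = 0"
      by (simp add: ml_erlang_def)
    ultimately show ?thesis using True by simp
  next
    case False
    with Suc.prems have "0 < t" by simp
    define F where "F y = prob {\<omega> \<in> space M. epoch n \<omega> \<le> y}" for y
    have "mono F"
      unfolding F_def by (intro monoI finite_measure_mono) auto
    then have [measurable]: "F \<in> borel_measurable borel"
      by (rule borel_measurable_mono)
    have "indep_var borel (T n) borel (\<lambda>\<omega>. \<Sum>i<n. T i \<omega>)"
      by (rule indep_vars_sum) (auto intro: indep_vars_subset[OF T_indep])
    then have "indep_var borel (epoch n) borel (T n)"
      unfolding epoch_def[abs_def] by (rule indep_var_commute)
    then have "indep_var borel (id \<circ> epoch n) borel ((\<lambda>s. t - s) \<circ> T n)"
      by (rule indep_var_compose) auto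
    then have "prob {\<omega> \<in> space M. epoch n \<omega> \<le> t - T n \<omega>} = expectation (\<lambda>\<omega>. F (t - T n \<omega>))"
      unfolding F_def using prob_le_indep_var[of "epoch n" "\<lambda>\<omega>. t - T n \<omega>"] by (simp add: o_def)
    also have "\<dots> = (LINT s|lborel. max 0 (interarrival_density lam \<alpha> s) * F (t - s))"
      by (rule expectation_T) measurable
    also have "\<dots> = (LINT s|lborel. indicat_real {0<..<t} s *
        (ml_erlang \<alpha> (2 * n) (lam * (t - s) powr \<alpha>) * interarrival_density lam \<alpha> s))"
    proof (rule integral_cong_AE)
      have "AE s in lborel. s \<noteq> t" "AE s in lborel. s \<noteq> (0::real)"
        by (rule AE_lborel_singleton)+
      then show "AE s in lborel. max 0 (interarrival_density lam \<alpha> s) * F (t - s) = indicat_real {0<..<t} s *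
          (ml_erlang \<alpha> (2 * n) (lam * (t - s) powr \<alpha>) * interarrival_density lam \<alpha> s)"
        using interarrival_density_nonneg
      proof eventually_elim
        case (elim s)
        consider "s < 0" | "t < s" | "s \<in> {0<..<t}" using elim by force
        then show ?case
        proof cases
          case 1
          then show ?thesis by (simp add: interarrival_density_def)
        next
          case 2
          then show ?thesis by (simp add: F_def prob_epoch_neg)
        next
          case 3
          then have "F (t - s) = ml_erlang \<alpha> (2 * n) (lam * (t - s) powr \<alpha>)"
            unfolding F_def by (intro Suc.IH) simp
          with 3 elim show ?thesis by simp
        qed
      qed
    qed measurable
    also have "\<dots> = ml_erlang \<alpha> (2 * n + 2) (lam * t powr \<alpha>)"
      using alpha_pos lam_pos \<open>0 < t\<close> by (intro ml_erlang_convolution) auto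
    finally show ?thesis by (simp add: epoch_def algebra_simps)
  qed
qed

lemma epoch_unbounded: "AE \<omega> in M. \<forall>b. \<exists>m. b < epoch m \<omega>"
proof -
  have "AE \<omega> in M. \<exists>m. real k < epoch m \<omega>" for k :: nat
  proof -
    let ?A = "{\<omega> \<in> space M. \<forall>m. epoch m \<omega> \<le> real k}"
    have A: "?A \<in> events" by measurable
    have "(\<lambda>m. ml_erlang \<alpha> (2 * m) (lam * real k powr \<alpha>)) \<longlonglongrightarrow> 0"
      using LIMSEQ_subseq_LIMSEQ[OF ml_erlang_tendsto_0[OF alpha_pos], of "\<lambda>m. 2 * m"]
      by (simp add: o_def strict_mono_def)
    moreover have "prob ?A \<le> ml_erlang \<alpha> (2 * m) (lam * real k powr \<alpha>)" for m
      unfolding prob_epoch_le[OF of_nat_0_le_iff, symmetric] by (intro finite_measure_mono) auto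
    ultimately have "prob ?A \<le> 0"
      by (intro LIMSEQ_le_const) auto
    then have "prob ?A = 0"
      using measure_nonneg[of M ?A] by linarith
    then have "AE \<omega> in M. \<not> (\<forall>m. epoch m \<omega> \<le> real k)"
      using prob_Collect_eq_0[OF A] by (simp only:)
    then show ?thesis by eventually_elim (auto simp: not_le)
  qed
  then have "AE \<omega> in M. \<forall>k::nat. \<exists>m. real k < epoch m \<omega>"
    by (intro iffD2[OF AE_all_countable] allI)
  then show ?thesis
  proof eventually_elim
    case (elim \<omega>)
    show ?case
    proof
      fix b :: real
      obtain k :: nat where "b \<le> real k" using real_arch_simple by blast
      moreover obtain m where "real k < epoch m \<omega>" using elim by blast
      ultimately have "b < epoch m \<omega>" by linarith
      then show "\<exists>m. b < epoch m \<omega>" ..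
    qed
  qed
qed

lemma le_renewal_count_iff:
  "AE \<omega> in M. \<forall>b\<ge>0. \<forall>n. n \<le> renewal_count T b \<omega> \<longleftrightarrow> epoch n \<omega> \<le> b"
  using epoch_mono epoch_unbounded
proof eventually_elim
  case (elim \<omega>)
  show ?case
    unfolding renewal_count_def epoch_def[symmetric]
    using elim by (intro allI impI le_card_sublevel_iff) auto
qed

lemma renewal_count_measurable [measurable]:
  assumes [measurable]: "X \<in> borel_measurable M"
  shows "(\<lambda>\<omega>. renewal_count T (X \<omega>) \<omega>) \<in> measurable M (count_space UNIV)"
  unfolding renewal_count_def by measurable

text \<open>
  Only independence from the counts is given, not from the interarrival times. But \<open>epoch n \<le> b\<close> agrees almost
  surely with \<open>n \<le> renewal_count T b\<close> for each fixed \<open>b\<close>, and these events generate the \<open>\<sigma>\<close>-algebra of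
  the epoch. In this way counts at fixed times suffice to handle the count at a random time.
\<close>

lemma indep_var_epoch:
  assumes X[measurable]: "X \<in> borel_measurable M"
    and indep: "\<And>b. 0 \<le> b \<Longrightarrow> indep_var borel X borel (\<lambda>\<omega>. real (renewal_count T b \<omega>))"
  shows "indep_var borel X borel (epoch n)"
proof (rule indep_var_atMostI)
  fix A :: "real set" and b assume [measurable]: "A \<in> sets borel"
  show "prob {\<omega> \<in> space M. X \<omega> \<in> A \<and> epoch n \<omega> \<le> b} = prob {\<omega> \<in> space M. X \<omega> \<in> A} * prob {\<omega> \<in> space M. epoch n \<omega> \<le> b}"
  proof (cases "0 \<le> b")
    case False
    then have "prob {\<omega> \<in> space M. epoch n \<omega> \<le> b} = 0" by (simp add: prob_epoch_neg)
    moreover have "prob {\<omega> \<in> space M. X \<omega> \<in> A \<and> epoch n \<omega> \<le> b} \<le> prob {\<omega> \<in> space M. epoch n \<omega> \<le> b}"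
      by (intro finite_measure_mono) auto
    ultimately show ?thesis
      using measure_nonneg[of M "{\<omega> \<in> space M. X \<omega> \<in> A \<and> epoch n \<omega> \<le> b}"] by simp
  next
    case True
    let ?N = "\<lambda>\<omega>. real (renewal_count T b \<omega>)"
    have [measurable]: "(\<lambda>\<omega>. renewal_count T b \<omega>) \<in> measurable M (count_space UNIV)"
      by (rule renewal_count_measurable) simp
    have "prob {\<omega> \<in> space M. X \<omega> \<in> A \<and> epoch n \<omega> \<le> b} = prob {\<omega> \<in> space M. X \<omega> \<in> A \<and> real n \<le> ?N \<omega>}"
    proof (rule finite_measure_eq_AE)
      show "AE \<omega> in M. (\<omega> \<in> {\<omega> \<in> space M. X \<omega> \<in> A \<and> epoch n \<omega> \<le> b}) = (\<omega> \<in> {\<omega> \<in> space M. X \<omega> \<in> A \<and> real n \<le> ?N \<omega>})"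
        using le_renewal_count_iff by eventually_elim (use True in simp)
    qed measurable
    also have "{\<omega> \<in> space M. X \<omega> \<in> A \<and> real n \<le> ?N \<omega>} = (\<lambda>\<omega>. (X \<omega>, ?N \<omega>)) -` (A \<times> {real n..}) \<inter> space M"
      by auto
    also have "prob \<dots> = prob (X -` A \<inter> space M) * prob (?N -` {real n..} \<inter> space M)"
      by (rule indep_varD[OF indep[OF True]]) auto
    also have "X -` A \<inter> space M = {\<omega> \<in> space M. X \<omega> \<in> A}" by auto
    also have "?N -` {real n..} \<inter> space M = {\<omega> \<in> space M. real n \<le> ?N \<omega>}" by auto
    also have "prob {\<omega> \<in> space M. real n \<le> ?N \<omega>} = prob {\<omega> \<in> space M. epoch n \<omega> \<le> b}"
    proof (rule finite_measure_eq_AE)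
      show "AE \<omega> in M. (\<omega> \<in> {\<omega> \<in> space M. real n \<le> ?N \<omega>}) = (\<omega> \<in> {\<omega> \<in> space M. epoch n \<omega> \<le> b})"
        using le_renewal_count_iff by eventually_elim (use True in simp)
    qed measurable
    finally show ?thesis .
  qed
qed measurable

text \<open>
  At the random time \<open>X\<close> the duality turns the event into \<open>epoch n \<le> X\<close>, a comparison of two independent
  random variables.
\<close>

lemma prob_le_renewal_count:
  assumes X[measurable]: "X \<in> borel_measurable M" and nonneg: "AE \<omega> in M. 0 \<le> X \<omega>"
    and indep: "\<And>b. 0 \<le> b \<Longrightarrow> indep_var borel X borel (\<lambda>\<omega>. real (renewal_count T b \<omega>))"
  shows "prob {\<omega> \<in> space M. n \<le> renewal_count T (X \<omega>) \<omega>} =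
      expectation (\<lambda>\<omega>. ml_erlang \<alpha> (2 * n) (lam * X \<omega> powr \<alpha>))"
    and "integrable M (\<lambda>\<omega>. ml_erlang \<alpha> (2 * n) (lam * X \<omega> powr \<alpha>))"
proof -
  define F where "F y = prob {\<omega> \<in> space M. epoch n \<omega> \<le> y}" for y
  have F: "AE \<omega> in M. F (X \<omega>) = ml_erlang \<alpha> (2 * n) (lam * X \<omega> powr \<alpha>)"
    using nonneg by eventually_elim (simp add: F_def prob_epoch_le)
  have "mono F"
    unfolding F_def by (intro monoI finite_measure_mono) auto
  then have [measurable]: "F \<in> borel_measurable borel"
    by (rule borel_measurable_mono)
  have "prob {\<omega> \<in> space M. n \<le> renewal_count T (X \<omega>) \<omega>} = prob {\<omega> \<in> space M. epoch n \<omega> \<le> X \<omega>}"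
  proof (rule finite_measure_eq_AE)
    show "AE \<omega> in M. (\<omega> \<in> {\<omega> \<in> space M. n \<le> renewal_count T (X \<omega>) \<omega>}) = (\<omega> \<in> {\<omega> \<in> space M. epoch n \<omega> \<le> X \<omega>})"
      using le_renewal_count_iff nonneg by eventually_elim simp
  qed measurable
  also have "\<dots> = expectation (\<lambda>\<omega>. F (X \<omega>))"
    unfolding F_def by (rule prob_le_indep_var[OF indep_var_commute[OF indep_var_epoch[OF X indep]]])
  also have "\<dots> = expectation (\<lambda>\<omega>. ml_erlang \<alpha> (2 * n) (lam * X \<omega> powr \<alpha>))"
    by (rule integral_cong_AE[OF _ _ F]) measurable
  finally show "prob {\<omega> \<in> space M. n \<le> renewal_count T (X \<omega>) \<omega>} =
      expectation (\<lambda>\<omega>. ml_erlang \<alpha> (2 * n) (lam * X \<omega> powr \<alpha>))" .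
  show "integrable M (\<lambda>\<omega>. ml_erlang \<alpha> (2 * n) (lam * X \<omega> powr \<alpha>))"
  proof (rule integrable_const_bound[of _ 1])
    show "AE \<omega> in M. norm (ml_erlang \<alpha> (2 * n) (lam * X \<omega> powr \<alpha>)) \<le> 1"
      using F
    proof eventually_elim
      case (elim \<omega>)
      have "0 \<le> F y" "F y \<le> 1" for y by (simp_all add: F_def)
      then show ?case unfolding elim[symmetric] by simp
    qed
  qed measurable
qed

end

section \<open>The subordinated process\<close>

text \<open>
  The convention \<open>rpow 0 0 = 1\<close> is the one of natural powers, so moments of \<open>x powr \<alpha>\<close> are
  moments of \<open>x\<close> in the sense of \<open>rpow\<close>, also at \<open>x = 0\<close>.
\<close>

lemma rpow_power:
  assumes "0 < \<alpha>"
  shows "rpow x (\<alpha> * real k) = (x powr \<alpha>) ^ k"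
proof (cases "k = 0 \<or> x = 0")
  case True
  then show ?thesis using assms by (auto simp: rpow_def power_0_left)
next
  case False
  then show ?thesis using assms
    by (simp add: rpow_def powr_powr[symmetric] powr_realpow)
qed

theorem theorem5p1:
  fixes M :: "'a measure"
    and T :: "nat \<Rightarrow> 'a \<Rightarrow> real"
    and D :: "real \<Rightarrow> 'a \<Rightarrow> real"
    and f :: "real \<Rightarrow> real"
    and lam \<alpha> t :: real
    and n :: nat
  assumes "prob_space M"
    and "0 < lam" and "0 < \<alpha>" and "\<alpha> \<le> 1"
    and interarrival_indep: "prob_space.indep_vars M (\<lambda>_. borel) T UNIV"
    and interarrival_law: "\<And>i. has_density M (T i) (interarrival_density lam \<alpha>)"
    and subordinator: "levy_subordinator M D f"
    and indep: "indep_processes M D (\<lambda>s \<omega>. real (renewal_count T s \<omega>))"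
    and moments: "\<And>s r. 0 \<le> s \<Longrightarrow> 0 < r \<Longrightarrow> integrable M (\<lambda>\<omega>. D s \<omega> powr r)"
    and "0 \<le> t"
    and convergent_even: "summable (\<lambda>k. fact (2 * n + k) / fact k
          * ((- lam) ^ k / Gamma (\<alpha> * real (2 * n + k) + 1))
          * (LINT \<omega>|M. rpow (D t \<omega>) (\<alpha> * real (2 * n + k))))"
    and convergent_odd: "summable (\<lambda>k. fact (2 * n + k + 1) / fact k
          * ((- lam) ^ k / Gamma (\<alpha> * real (2 * n + k + 1) + 1))
          * (LINT \<omega>|M. rpow (D t \<omega>) (\<alpha> * real (2 * n + k + 1))))"
  shows "measure M {\<omega> \<in> space M. renewal_count T (D t \<omega>) \<omega> = n} =
      lam ^ (2 * n) / fact (2 * n) *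
        (\<Sum>k. fact (2 * n + k) / fact k
          * ((- lam) ^ k / Gamma (\<alpha> * real (2 * n + k) + 1))
          * (LINT \<omega>|M. rpow (D t \<omega>) (\<alpha> * real (2 * n + k))))
    + lam ^ (2 * n + 1) / fact (2 * n + 1) *
        (\<Sum>k. fact (2 * n + k + 1) / fact k
          * ((- lam) ^ k / Gamma (\<alpha> * real (2 * n + k + 1) + 1))
          * (LINT \<omega>|M. rpow (D t \<omega>) (\<alpha> * real (2 * n + k + 1))))"
proof -
  interpret prob_space M by fact
  interpret ml_renewal M T lam \<alpha>
    by unfold_locales (fact assms)+
  define X where "X = D t"
  define Z where "Z \<omega> = lam * X \<omega> powr \<alpha>" for \<omega>
  have levy: "levy_process M D" and D_mono: "AE \<omega> in M. mono_on {0..} (\<lambda>t. D t \<omega>)"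
    using subordinator by (auto simp only: levy_subordinator_def)
  have X[measurable]: "X \<in> borel_measurable M"
    using levy \<open>0 \<le> t\<close> by (simp add: levy_process_def X_def)
  have Z[measurable]: "Z \<in> borel_measurable M"
    unfolding Z_def[abs_def] by measurable
  have "AE \<omega> in M. D 0 \<omega> = 0"
    using levy by (simp only: levy_process_def)
  with D_mono have X_nonneg: "AE \<omega> in M. 0 \<le> X \<omega>"
  proof eventually_elim
    case (elim \<omega>)
    then have "D 0 \<omega> \<le> D t \<omega>" using \<open>0 \<le> t\<close> by (intro mono_onD[of "{0..}" "\<lambda>t. D t \<omega>"]) auto
    with elim show ?case by (simp add: X_def)
  qed
  have Z_nonneg: "AE \<omega> in M. 0 \<le> Z \<omega>"
    using \<open>0 < lam\<close> by (simp add: Z_def)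
  have X_indep: "indep_var borel X borel (\<lambda>\<omega>. real (renewal_count T b \<omega>))" if "0 \<le> b" for b
  proof -
    have "indep_var borel ((\<lambda>p. p t) \<circ> (\<lambda>\<omega>. \<lambda>s\<in>{0..}. D s \<omega>))
        borel ((\<lambda>p. p b) \<circ> (\<lambda>\<omega>. \<lambda>s\<in>{0..}. real (renewal_count T s \<omega>)))"
    proof (rule indep_var_compose[OF indep[unfolded indep_processes_def]])
      show "(\<lambda>p. p t) \<in> borel_measurable (Pi\<^sub>M {0..} (\<lambda>_. borel))"
        using \<open>0 \<le> t\<close> by (intro measurable_component_singleton) simp
      show "(\<lambda>p. p b) \<in> borel_measurable (Pi\<^sub>M {0..} (\<lambda>_. borel))"
        using that by (intro measurable_component_singleton) simp
    qed
    then show ?thesis using \<open>0 \<le> t\<close> that by (simp add: o_def X_def)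
  qed
  have Z_power: "Z \<omega> ^ k = lam ^ k * rpow (X \<omega>) (\<alpha> * real k)" for \<omega> k
    unfolding Z_def rpow_power[OF \<open>0 < \<alpha>\<close>] power_mult_distrib ..
  have Z_moments: "integrable M (\<lambda>\<omega>. Z \<omega> ^ k)" for k
    unfolding Z_power
    using moments[OF \<open>0 \<le> t\<close>, of "\<alpha> * real k"] \<open>0 < \<alpha>\<close>
    by (cases "k = 0") (auto simp: rpow_def X_def)
  \<comment> \<open>Convergence of the series enters only through its terms, which form the null sequence required by
    \<open>expectation_altexp_sums\<close>.\<close>
  have taylor: "integrable M (\<lambda>\<omega>. ml_erlang \<alpha> r (Z \<omega>) - ml_erlang \<alpha> (Suc r) (Z \<omega>))"
      "expectation (\<lambda>\<omega>. ml_erlang \<alpha> r (Z \<omega>) - ml_erlang \<alpha> (Suc r) (Z \<omega>)) =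
        lam ^ r / fact r * (\<Sum>k. fact (r + k) / fact k * ((- lam) ^ k / Gamma (\<alpha> * real (r + k) + 1))
          * expectation (\<lambda>\<omega>. rpow (X \<omega>) (\<alpha> * real (r + k))))"
    if summable: "summable (\<lambda>k. fact (r + k) / fact k * ((- lam) ^ k / Gamma (\<alpha> * real (r + k) + 1))
          * expectation (\<lambda>\<omega>. rpow (X \<omega>) (\<alpha> * real (r + k))))" (is "summable ?t") for r
  proof -
    define c where "c k = ml_coeff \<alpha> (k + r)" for k
    have c: "entire_egf c" "cm_seq c"
      unfolding c_def using entire_egf_shift[OF entire_ml_coeff] cm_seq_shift[OF cm_seq_ml_coeff] assms(3,4) by auto
    have term_eq: "c k * (-1) ^ k * expectation (\<lambda>\<omega>. Z \<omega> ^ (r + k)) / fact k = lam ^ r * ?t k" for k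
    proof -
      have "(- lam) ^ k = (-1) ^ k * lam ^ k" by (rule power_minus)
      then show ?thesis
        unfolding Z_power c_def ml_coeff_def by (simp add: power_add add.commute[of r] mult_ac)
    qed
    have "(\<lambda>k. lam ^ r * ?t k) \<longlonglongrightarrow> 0"
      by (rule tendsto_mult_right_zero[OF summable_LIMSEQ_zero[OF summable]])
    then have null: "(\<lambda>k. c k * (-1) ^ k * expectation (\<lambda>\<omega>. Z \<omega> ^ (r + k)) / fact k) \<longlonglongrightarrow> 0"
      by (simp only: term_eq)
    note sums = expectation_altexp_sums[OF c Z Z_nonneg Z_moments null]
    have diff: "ml_erlang \<alpha> r x - ml_erlang \<alpha> (Suc r) x = 1 / fact r * (x ^ r * altexp c x)" for x
      unfolding ml_erlang_diff[OF \<open>0 < \<alpha>\<close>] c_def by simp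
    show "integrable M (\<lambda>\<omega>. ml_erlang \<alpha> r (Z \<omega>) - ml_erlang \<alpha> (Suc r) (Z \<omega>))"
      unfolding diff by (intro integrable_mult_right sums)
    have "(\<lambda>k. lam ^ r * ?t k) sums expectation (\<lambda>\<omega>. Z \<omega> ^ r * altexp c (Z \<omega>))"
      using sums(2) by (simp only: term_eq)
    moreover have "(\<lambda>k. lam ^ r * ?t k) sums (lam ^ r * suminf ?t)"
      by (intro sums_mult summable_sums summable)
    ultimately have "expectation (\<lambda>\<omega>. Z \<omega> ^ r * altexp c (Z \<omega>)) = lam ^ r * suminf ?t"
      by (rule sums_unique2)
    then show "expectation (\<lambda>\<omega>. ml_erlang \<alpha> r (Z \<omega>) - ml_erlang \<alpha> (Suc r) (Z \<omega>)) = lam ^ r / fact r * suminf ?t"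
      unfolding diff by simp
  qed
  have odd_index: "2 * n + k + 1 = (2 * n + 1) + k" for k by simp
  note even = taylor[OF convergent_even[folded X_def]]
  note odd = taylor[OF convergent_odd[folded X_def, unfolded odd_index]]
  let ?N = "\<lambda>\<omega>. renewal_count T (X \<omega>) \<omega>"
  let ?E = "\<lambda>r \<omega>. ml_erlang \<alpha> r (Z \<omega>)"
  have tail: "prob {\<omega> \<in> space M. m \<le> ?N \<omega>} = expectation (?E (2 * m))" "integrable M (?E (2 * m))" for m
    unfolding Z_def by (rule prob_le_renewal_count[OF X X_nonneg X_indep], assumption)+
  have N_sets: "{\<omega> \<in> space M. m \<le> ?N \<omega>} \<in> events" for m
    by measurable
  have "{\<omega> \<in> space M. ?N \<omega> = n} = {\<omega> \<in> space M. n \<le> ?N \<omega>} - {\<omega> \<in> space M. Suc n \<le> ?N \<omega>}"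
    by auto
  moreover have "{\<omega> \<in> space M. Suc n \<le> ?N \<omega>} \<subseteq> {\<omega> \<in> space M. n \<le> ?N \<omega>}"
    by auto
  ultimately have "prob {\<omega> \<in> space M. ?N \<omega> = n} = prob {\<omega> \<in> space M. n \<le> ?N \<omega>} - prob {\<omega> \<in> space M. Suc n \<le> ?N \<omega>}"
    using finite_measure_Diff[OF N_sets N_sets, of "Suc n" n] by (simp only:)
  also have "\<dots> = expectation (\<lambda>\<omega>. ?E (2 * n) \<omega> - ?E (2 * Suc n) \<omega>)"
    unfolding tail(1) by (rule Bochner_Integration.integral_diff[OF tail(2) tail(2), symmetric])
  also have "\<dots> = expectation (\<lambda>\<omega>. (?E (2 * n) \<omega> - ?E (Suc (2 * n)) \<omega>) + (?E (2 * n + 1) \<omega> - ?E (Suc (2 * n + 1)) \<omega>))"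
    by simp
  also have "\<dots> = expectation (\<lambda>\<omega>. ?E (2 * n) \<omega> - ?E (Suc (2 * n)) \<omega>)
      + expectation (\<lambda>\<omega>. ?E (2 * n + 1) \<omega> - ?E (Suc (2 * n + 1)) \<omega>)"
    by (rule Bochner_Integration.integral_add[OF even(1) odd(1)])
  finally show ?thesis
    unfolding even(2) odd(2) X_def odd_index .
qed

end
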